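(* Let $\Omega\subset\mathbb{R}^n$ be open and uniformly convex. Let $f\in C^0(\bar\Omega\times\mathbb{R}\times\mathbb{R}^n)$ be non-negative and non-decreasing in its second argument, and suppose that for every $R>0$ there exists a constant $C_R\ge 0$ such that $|f^{1/n}(x,s,p)-f^{1/n}(x,s,q)|\le C_R|p-q|$ for every $x\in\bar\Omega$, $|s|\le R$, and $|p|,|q|\le R$. Let $g:\partial\Omega\to\mathbb{R}$ and let $u\in C^{0,1}(\bar\Omega)$, with $u=g$ on $\partial\Omega$, be the unique viscosity solution of the generalised Dirichlet problem for the Monge-Amp\`ere equation with right-hand side $f$ and boundary data $g$. Let $F^h$ ($h>0$) be any consistent, monotone, stable approximation scheme for this generalised Dirichlet problem, and let $u^h$ be any solution of the scheme $F^h(x,u^h(x),u^h(x)-u^h(\cdot))=0$. Then $u^h$ converges to $u$ pointwise on $\bar\Omega$ as $h\to 0$; that is, for every $x\in\bar\Omega$ and every choice of grid points $z_h\in\mathcal{G}^h$ with $z_h\to x$ as $h\to0$, $u^h(z_h)\to u(x)$.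
   Context: Uniform convexity of $\Omega$: $\Omega$ is convex and there is $\alpha>0$ such that for every $x_0\in\partial\Omega$ and every unit outward normal $n$ to a supporting hyperplane of $\Omega$ at $x_0$, one has $(x-x_0)\cdot n\le -\alpha|x-x_0|^2$ for all $x\in\bar\Omega$ (in particular $\Omega$ is bounded). Modified determinant: let $\mathcal{S}^n$ be the real symmetric $n\times n$ matrices. ${\det}^+:\mathcal{S}^n\to\mathbb{R}$ is a fixed continuous function, non-decreasing with respect to the usual order on $\mathcal{S}^n$, with ${\det}^+(X)=\det(X)$ if $X\ge 0$ (positive semidefinite) and ${\det}^+(X)<0$ otherwise. Generalised Dirichlet problem for the Monge-Amp\`ere equation: it is the equation $F(x,u,\nabla u,D^2u)=0$ on $\bar\Omega$, where $F(x,s,p,X)=-{\det}^+(X)+f(x,s,p)$ for $x\in\Omega$ and $F(x,s,p,X)=s-g(x)$ for $x\in\partial\Omega$. Its lower and upper semicontinuous envelopes are $F_*(x,s,p,X)=F^*(x,s,p,X)=-{\det}^+(X)+f(x,s,p)$ for $x\in\Omega$, and, for $x\in\partial\Omega$, $F_*(x,s,p,X)=\min\{s-g(x),\,-{\det}^+(X)+f(x,s,p)\}$ and $F^*(x,s,p,X)=\max\{s-g(x),\,-{\det}^+(X)+f(x,s,p)\}$. An upper semicontinuous function $v:\bar\Omega\to\mathbb{R}$ is a viscosity subsolution if for every $\phi\in C^2(\bar\Omega)$ and every $x\in\bar\Omega$ at which $v-\phi$ has a local maximum (relative to $\bar\Omega$), $F_*(x,v(x),\nabla\phi(x),D^2\phi(x))\le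 0$. A lower semicontinuous function $w:\bar\Omega\to\mathbb{R}$ is a viscosity supersolution if for every $\phi\in C^2(\bar\Omega)$ and every $x\in\bar\Omega$ at which $w-\phi$ has a local minimum (relative to $\bar\Omega$), $F^*(x,w(x),\nabla\phi(x),D^2\phi(x))\ge 0$. A function $u$ on $\bar\Omega$ is a viscosity solution if its upper semicontinuous envelope $u^*(x)=\limsup_{y\to x}u(y)$ is a subsolution and its lower semicontinuous envelope $u_*(x)=\liminf_{y\to x}u(y)$ is a supersolution. Approximation schemes: for each $h>0$ let $\mathcal{G}^h\subset\bar\Omega$ be a finite set of grid points, such that every $x\in\bar\Omega$ is a limit of points $z_h\in\mathcal{G}^h$ as $h\to0$. A scheme is a family of real-valued functions $F^h(x,s,\psi(\cdot))$ of $x\in\mathcal{G}^h$, $s\in\mathbb{R}$ and $\psi:\mathcal{G}^h\to\mathbb{R}$; a solution of the scheme is a function $u^h:\mathcal{G}^h\to\mathbb{R}$ with $F^h(x,u^h(x),u^h(x)-u^h(\cdot))=0$ for all $x\in\mathcal{G}^h$, where $u^h(x)-u^h(\cdot)$ denotes the function $y\mapsto u^h(x)-u^h(y)$. - Consistent: for every smooth function $\phi$ and every $x\in\bar\Omega$, $$\limsup_{h\to0,\ z\in\mathcal{G}^h\to x,\ \xi\to0}F^h(z,\phi(z)+\xi,\phi(z)-\phi(\cdot))\le F^*(x,\phi(x),\nabla\phi(x),D^2\phi(x)),$$ $$\liminf_{h\to0,\ z\in\mathcal{G}^h\to x,\ \xi\to0}F^h(z,\phi(z)+\xi,\phi(z)-\phi(\cdot))\ge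 F_*(x,\phi(x),\nabla\phi(x),D^2\phi(x)).$$ - Monotone: $F^h$ is a non-decreasing function of its final two arguments (with the pointwise order on functions for the last one). - Stable: there is a constant $M\in\mathbb{R}$, independent of $h$, such that any solution $u^h$ of the scheme satisfies $\|u^h\|_\infty\le M$ for all sufficiently small $h>0$. *)

theory Defs
  imports "HOL-Analysis.Analysis"
begin

section \<open>The domain\<close>

text \<open>Boundedness is stated separately because the quadratic condition does not exclude
  the whole space, whose boundary is empty; it follows from the other conditions in all other
  cases.\<close>

definition uniformly_convex :: "(real^'n) set \<Rightarrow> bool" where
  "uniformly_convex \<Omega> \<longleftrightarrow> convex \<Omega> \<and> bounded \<Omega> \<and>
    (\<exists>\<alpha>>0. \<forall>x0\<in>frontier \<Omega>. \<forall>\<nu>.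
       norm \<nu> = 1 \<and> (\<forall>x\<in>closure \<Omega>. (x - x0) \<bullet> \<nu> \<le> 0) \<longrightarrow>
       (\<forall>x\<in>closure \<Omega>. (x - x0) \<bullet> \<nu> \<le> - \<alpha> * (norm (x - x0))\<^sup>2))"


section \<open>Symmetric matrices and the modified determinant\<close>

definition sym_matrices :: "(real^'n^'n) set" where
  "sym_matrices = {X. transpose X = X}"

definition psd :: "real^'n^'n \<Rightarrow> bool" where
  "psd X \<longleftrightarrow> X \<in> sym_matrices \<and> (\<forall>v. 0 \<le> v \<bullet> (X *v v))"

text \<open>Only the values on symmetric matrices are constrained.\<close>

definition modified_det :: "(real^'n^'n \<Rightarrow> real) \<Rightarrow> bool" where
  "modified_det detp \<longleftrightarrow>
     continuous_on sym_matrices detp \<and>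
     (\<forall>X\<in>sym_matrices. \<forall>Y\<in>sym_matrices. psd (Y - X) \<longrightarrow> detp X \<le> detp Y) \<and>
     (\<forall>X\<in>sym_matrices. if psd X then detp X = det X else detp X < 0)"


section \<open>Functions that are differentiable up to the boundary\<close>

text \<open>As usual, \<open>C\<^sup>k\<close> on the closure of an open set \<open>\<Omega>\<close> means \<open>C\<^sup>k\<close> in \<open>\<Omega>\<close> with all derivatives of
  order at most \<open>k\<close> extending continuously to \<open>closure \<Omega>\<close>. The functions \<open>G\<close> and \<open>H\<close> below are the
  gradient and the Hessian together with their (unique) continuous extensions, so that they also
  give the derivatives at boundary points.\<close>

definition C2_closure ::
  "(real^'n) set \<Rightarrow> (real^'n \<Rightarrow> real) \<Rightarrow> (real^'n \<Rightarrow> real^'n) \<Rightarrow> (real^'n \<Rightarrow> real^'n^'n) \<Rightarrow> bool" where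
  "C2_closure \<Omega> \<phi> G H \<longleftrightarrow>
     continuous_on (closure \<Omega>) \<phi> \<and> continuous_on (closure \<Omega>) G \<and> continuous_on (closure \<Omega>) H \<and>
     (\<forall>x\<in>\<Omega>. GDERIV \<phi> x :> G x \<and> (G has_derivative (\<lambda>v. H x *v v)) (at x))"

fun Ck_closure :: "nat \<Rightarrow> (real^'n) set \<Rightarrow> (real^'n \<Rightarrow> real) \<Rightarrow> bool" where
  "Ck_closure 0 \<Omega> \<phi> \<longleftrightarrow> continuous_on (closure \<Omega>) \<phi>"
| "Ck_closure (Suc k) \<Omega> \<phi> \<longleftrightarrow> continuous_on (closure \<Omega>) \<phi> \<and>
     (\<exists>G. (\<forall>x\<in>\<Omega>. GDERIV \<phi> x :> G x) \<and> (\<forall>i. Ck_closure k \<Omega> (\<lambda>x. G x $ i)))"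

definition smooth_closure :: "(real^'n) set \<Rightarrow> (real^'n \<Rightarrow> real) \<Rightarrow> bool" where
  "smooth_closure \<Omega> \<phi> \<longleftrightarrow> (\<forall>k. Ck_closure k \<Omega> \<phi>)"


section \<open>Semicontinuity\<close>

definition usc_on :: "'a::topological_space set \<Rightarrow> ('a \<Rightarrow> real) \<Rightarrow> bool" where
  "usc_on S v \<longleftrightarrow> (\<forall>x\<in>S. \<forall>c>v x. \<forall>\<^sub>F y in at x within S. v y < c)"

definition lsc_on :: "'a::topological_space set \<Rightarrow> ('a \<Rightarrow> real) \<Rightarrow> bool" where
  "lsc_on S w \<longleftrightarrow> (\<forall>x\<in>S. \<forall>c<w x. \<forall>\<^sub>F y in at x within S. c < w y)"

text \<open>The filter includes the point \<open>x\<close> itself, so these are the smallest usc majorant and the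
  largest lsc minorant of \<open>u\<close> on \<open>S\<close>.\<close>

definition usc_envelope :: "'a::topological_space set \<Rightarrow> ('a \<Rightarrow> real) \<Rightarrow> 'a \<Rightarrow> ereal" where
  "usc_envelope S u x = Limsup (inf (nhds x) (principal S)) (\<lambda>y. ereal (u y))"

definition lsc_envelope :: "'a::topological_space set \<Rightarrow> ('a \<Rightarrow> real) \<Rightarrow> 'a \<Rightarrow> ereal" where
  "lsc_envelope S u x = Liminf (inf (nhds x) (principal S)) (\<lambda>y. ereal (u y))"


section \<open>The generalised Dirichlet problem\<close>

text \<open>The envelopes of the operator that equals \<open>- detp X + f x s p\<close> in \<open>\<Omega>\<close> and
  \<open>s - g x\<close> on the boundary. They are only used for \<open>x\<close> in the closure of the open set \<open>\<Omega>\<close>,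
  so the second branch is the case of a boundary point.\<close>

definition MA_lower ::
  "(real^'n) set \<Rightarrow> (real^'n^'n \<Rightarrow> real) \<Rightarrow> (real^'n \<Rightarrow> real \<Rightarrow> real^'n \<Rightarrow> real) \<Rightarrow> (real^'n \<Rightarrow> real)
   \<Rightarrow> real^'n \<Rightarrow> real \<Rightarrow> real^'n \<Rightarrow> real^'n^'n \<Rightarrow> real" where
  "MA_lower \<Omega> detp f g x s p X =
     (if x \<in> \<Omega> then - detp X + f x s p else min (s - g x) (- detp X + f x s p))"

definition MA_upper ::
  "(real^'n) set \<Rightarrow> (real^'n^'n \<Rightarrow> real) \<Rightarrow> (real^'n \<Rightarrow> real \<Rightarrow> real^'n \<Rightarrow> real) \<Rightarrow> (real^'n \<Rightarrow> real)
   \<Rightarrow> real^'n \<Rightarrow> real \<Rightarrow> real^'n \<Rightarrow> real^'n^'n \<Rightarrow> real" where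
  "MA_upper \<Omega> detp f g x s p X =
     (if x \<in> \<Omega> then - detp X + f x s p else max (s - g x) (- detp X + f x s p))"

definition viscosity_subsolution ::
  "(real^'n) set \<Rightarrow> (real^'n^'n \<Rightarrow> real) \<Rightarrow> (real^'n \<Rightarrow> real \<Rightarrow> real^'n \<Rightarrow> real) \<Rightarrow> (real^'n \<Rightarrow> real)
   \<Rightarrow> (real^'n \<Rightarrow> real) \<Rightarrow> bool" where
  "viscosity_subsolution \<Omega> detp f g v \<longleftrightarrow> usc_on (closure \<Omega>) v \<and>
     (\<forall>\<phi> G H. C2_closure \<Omega> \<phi> G H \<longrightarrow>
        (\<forall>x\<in>closure \<Omega>. (\<forall>\<^sub>F y in at x within closure \<Omega>. v y - \<phi> y \<le> v x - \<phi> x) \<longrightarrow>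
           MA_lower \<Omega> detp f g x (v x) (G x) (H x) \<le> 0))"

definition viscosity_supersolution ::
  "(real^'n) set \<Rightarrow> (real^'n^'n \<Rightarrow> real) \<Rightarrow> (real^'n \<Rightarrow> real \<Rightarrow> real^'n \<Rightarrow> real) \<Rightarrow> (real^'n \<Rightarrow> real)
   \<Rightarrow> (real^'n \<Rightarrow> real) \<Rightarrow> bool" where
  "viscosity_supersolution \<Omega> detp f g w \<longleftrightarrow> lsc_on (closure \<Omega>) w \<and>
     (\<forall>\<phi> G H. C2_closure \<Omega> \<phi> G H \<longrightarrow>
        (\<forall>x\<in>closure \<Omega>. (\<forall>\<^sub>F y in at x within closure \<Omega>. w y - \<phi> y \<ge> w x - \<phi> x) \<longrightarrow>
           MA_upper \<Omega> detp f g x (w x) (G x) (H x) \<ge> 0))"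

text \<open>Sub- and supersolutions are real-valued, so being a solution includes the finiteness of
  both envelopes; \<open>v\<close> and \<open>w\<close> below are these envelopes as real functions.\<close>

definition viscosity_solution ::
  "(real^'n) set \<Rightarrow> (real^'n^'n \<Rightarrow> real) \<Rightarrow> (real^'n \<Rightarrow> real \<Rightarrow> real^'n \<Rightarrow> real) \<Rightarrow> (real^'n \<Rightarrow> real)
   \<Rightarrow> (real^'n \<Rightarrow> real) \<Rightarrow> bool" where
  "viscosity_solution \<Omega> detp f g u \<longleftrightarrow>
     (\<exists>v. (\<forall>x\<in>closure \<Omega>. ereal (v x) = usc_envelope (closure \<Omega>) u x) \<and>
          viscosity_subsolution \<Omega> detp f g v) \<and>
     (\<exists>w. (\<forall>x\<in>closure \<Omega>. ereal (w x) = lsc_envelope (closure \<Omega>) u x) \<and>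
          viscosity_supersolution \<Omega> detp f g w)"


section \<open>Approximation schemes\<close>

definition grid_family :: "(real^'n) set \<Rightarrow> (real \<Rightarrow> (real^'n) set) \<Rightarrow> bool" where
  "grid_family \<Omega> Gr \<longleftrightarrow>
     (\<forall>h>0. finite (Gr h) \<and> Gr h \<subseteq> closure \<Omega>) \<and>
     (\<forall>x\<in>closure \<Omega>. \<exists>z. (\<forall>h>0. z h \<in> Gr h) \<and> (z \<longlongrightarrow> x) (at_right 0))"

text \<open>Grid functions are represented by functions on the whole space. Since the order in
  \<open>scheme_monotone\<close> only compares values on the grid, monotonicity forces \<open>F h x s \<psi>\<close> to depend
  only on the restriction of \<open>\<psi>\<close> to the grid.\<close>

type_synonym 'n scheme = "real \<Rightarrow> real^'n \<Rightarrow> real \<Rightarrow> (real^'n \<Rightarrow> real) \<Rightarrow> real"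

definition scheme_monotone :: "(real \<Rightarrow> (real^'n) set) \<Rightarrow> 'n scheme \<Rightarrow> bool" where
  "scheme_monotone Gr F \<longleftrightarrow>
     (\<forall>h>0. \<forall>x\<in>Gr h. \<forall>s t \<psi> \<psi>'. s \<le> t \<longrightarrow> (\<forall>y\<in>Gr h. \<psi> y \<le> \<psi>' y) \<longrightarrow> F h x s \<psi> \<le> F h x t \<psi>')"

definition scheme_solution ::
  "(real \<Rightarrow> (real^'n) set) \<Rightarrow> 'n scheme \<Rightarrow> real \<Rightarrow> (real^'n \<Rightarrow> real) \<Rightarrow> bool" where
  "scheme_solution Gr F h u \<longleftrightarrow> (\<forall>x\<in>Gr h. F h x (u x) (\<lambda>y. u x - u y) = 0)"

definition scheme_stable :: "(real \<Rightarrow> (real^'n) set) \<Rightarrow> 'n scheme \<Rightarrow> bool" where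
  "scheme_stable Gr F \<longleftrightarrow>
     (\<exists>M. \<forall>\<^sub>F h in at_right 0. \<forall>u. scheme_solution Gr F h u \<longrightarrow> (\<forall>x\<in>Gr h. \<bar>u x\<bar> \<le> M))"

text \<open>The triples \<open>(h, z, \<xi>)\<close> with \<open>h \<rightarrow> 0\<close> from the right, \<open>z \<in> Gr h\<close>, \<open>z \<rightarrow> x\<close>, \<open>\<xi> \<rightarrow> 0\<close>.\<close>

definition grid_filter ::
  "(real \<Rightarrow> (real^'n) set) \<Rightarrow> real^'n \<Rightarrow> (real \<times> (real^'n) \<times> real) filter" where
  "grid_filter Gr x =
     inf (at_right 0 \<times>\<^sub>F nhds x \<times>\<^sub>F nhds 0) (principal {(h, z, \<xi>). z \<in> Gr h})"

definition scheme_consistent ::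
  "(real^'n) set \<Rightarrow> (real^'n^'n \<Rightarrow> real) \<Rightarrow> (real^'n \<Rightarrow> real \<Rightarrow> real^'n \<Rightarrow> real) \<Rightarrow> (real^'n \<Rightarrow> real)
   \<Rightarrow> (real \<Rightarrow> (real^'n) set) \<Rightarrow> 'n scheme \<Rightarrow> bool" where
  "scheme_consistent \<Omega> detp f g Gr F \<longleftrightarrow>
     (\<forall>\<phi> G H. smooth_closure \<Omega> \<phi> \<and> C2_closure \<Omega> \<phi> G H \<longrightarrow>
        (\<forall>x\<in>closure \<Omega>.
           Limsup (grid_filter Gr x) (\<lambda>(h, z, \<xi>). ereal (F h z (\<phi> z + \<xi>) (\<lambda>y. \<phi> z - \<phi> y)))
             \<le> ereal (MA_upper \<Omega> detp f g x (\<phi> x) (G x) (H x)) \<and>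
           Liminf (grid_filter Gr x) (\<lambda>(h, z, \<xi>). ereal (F h z (\<phi> z + \<xi>) (\<lambda>y. \<phi> z - \<phi> y)))
             \<ge> ereal (MA_lower \<Omega> detp f g x (\<phi> x) (G x) (H x))))"

end

theory Submission
  imports Defs
begin

text \<open>By the argument of Barles and Souganidis the upper half-relaxed limit \<open>U\<close> of the scheme solutions
  is a subsolution and the lower one \<open>L \<le> U\<close> is a supersolution. No comparison principle is needed
  to conclude: uniqueness is assumed among discontinuous solutions, so it is enough to find a
  function \<open>v\<close> whose upper and lower envelopes are \<open>U\<close> and \<open>L\<close>. Then \<open>v\<close> is a solution, hence \<open>v = u\<close>,
  and \<open>U = u = L\<close> because \<open>u\<close> is continuous.

  Such a \<open>v\<close> takes the value \<open>U\<close> on a countable set over which the graph of \<open>U\<close> is dense, and \<open>L\<close>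
  elsewhere. The only obstructions are isolated downward jumps of \<open>L\<close>. At these every test function
  touches \<open>L\<close> from below, so they lie on the boundary and \<open>L \<ge> g\<close> there, while uniform convexity
  yields \<open>U \<le> g\<close> on the whole boundary; hence \<open>L = U\<close> at the obstructing points.\<close>

section \<open>Matrices and the symmetry of Hessians\<close>

text \<open>Consistency is stated for smooth functions and involves their values on the whole grid,
  whereas a viscosity test function is only C^2 and touches only locally. Each test function is
  therefore replaced by a polynomial of degree four: it has the same gradient at the contact point,
  a Hessian shifted by a small multiple of the identity, and a quartic term that makes the contact
  global. Continuity of \<open>detp\<close> removes the shift afterwards. As \<open>detp\<close> is
  constrained on symmetric matrices only, this requires symmetric Hessians up to the boundary, which
  \<open>C2_closure\<close> does not include.

  In the gluing, changing \<open>L\<close> on a countable set can hide its lower envelope only where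
  a closed sublevel set of \<open>L\<close> is locally countable, and a nonempty set of that kind
  has isolated points. This is why isolated jumps are the only obstruction. Agreement of
  \<open>U\<close> and \<open>L\<close> is needed just there: elsewhere on the boundary the bound U
  \<le> g has no counterpart L \<ge> g.\<close>

lemma bounded_bilinear_matrix_vector_mult:
  "bounded_bilinear ((*v) :: real^'n^'m \<Rightarrow> real^'n \<Rightarrow> real^'m)"
proof -
  have "linear (\<lambda>A::real^'n^'m. A *v x)" for x :: "real^'n"
    by (rule linearI) (simp_all add: matrix_vector_mult_add_rdistrib scaleR_matrix_vector_assoc)
  then have "bilinear ((*v) :: real^'n^'m \<Rightarrow> real^'n \<Rightarrow> real^'m)"
    by (simp add: bilinear_def)
  then show ?thesis
    by (simp add: bilinear_conv_bounded_bilinear)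
qed

lemmas continuous_on_matrix_vector_mult =
  bounded_bilinear.continuous_on [OF bounded_bilinear_matrix_vector_mult]

lemma matrix_inner_commute:
  fixes A :: "real^'n^'n"
  assumes "A \<in> sym_matrices"
  shows "x \<bullet> (A *v y) = y \<bullet> (A *v x)"
proof -
  have "x \<bullet> (A *v y) = (transpose A *v x) \<bullet> y"
    by (simp add: dot_lmul_matrix)
  also have "transpose A = A"
    using assms by (simp add: sym_matrices_def)
  finally show ?thesis
    by (simp add: inner_commute)
qed

lemma sym_matricesI:
  fixes A :: "real^'n^'n"
  assumes "\<And>x y. x \<bullet> (A *v y) = y \<bullet> (A *v x)"
  shows "A \<in> sym_matrices"
proof -
  have "A $ i $ j = A $ j $ i" for i j
    using assms[of "axis i 1" "axis j 1"]
    by (simp add: inner_axis' matrix_vector_mul_component inner_axis)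
  then show ?thesis
    by (simp add: sym_matrices_def transpose_def vec_eq_iff)
qed

lemma mat_mult_vector: "mat c *v (v::real^'n) = c *\<^sub>R v"
proof -
  have "(mat c :: real^'n^'n) = c *\<^sub>R mat 1"
    by (simp add: vec_eq_iff mat_def)
  then show ?thesis
    by (simp add: scaleR_matrix_vector_assoc[symmetric])
qed

lemma mat_in_sym_matrices: "(mat c :: real^'n^'n) \<in> sym_matrices"
  by (simp add: sym_matrices_def transpose_mat)

lemma sym_matrices_add: "A \<in> sym_matrices \<Longrightarrow> B \<in> sym_matrices \<Longrightarrow> A + B \<in> sym_matrices"
  by (simp add: sym_matrices_def transpose_def vec_eq_iff)

lemma sym_matrices_minus: "A \<in> sym_matrices \<Longrightarrow> - A \<in> sym_matrices"
  by (simp add: sym_matrices_def transpose_def vec_eq_iff)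

lemma not_psd_mat:
  assumes "c < 0"
  shows "\<not> psd (mat c :: real^'n^'n)"
proof -
  \<comment> \<open>Any index would do, and \<open>undefined\<close> is one: on a unit vector the
    quadratic form of \<open>mat c\<close> equals c.\<close>
  have "axis undefined 1 \<bullet> ((mat c :: real^'n^'n) *v axis undefined 1) = c"
    by (simp add: mat_mult_vector inner_axis_axis)
  then show ?thesis
    unfolding psd_def using assms by (metis not_less)
qed

lemma psd_mat: "0 \<le> c \<Longrightarrow> psd (mat c :: real^'n^'n)"
  by (simp add: psd_def mat_in_sym_matrices mat_mult_vector)

lemma det_mat_power: "det (mat c :: real^'n^'n) = c ^ CARD('n)"
  by (subst det_diagonal) (simp_all add: mat_def)

text \<open>Multiples of the identity are the only matrices at which \<open>detp\<close> is ever
  evaluated: negative ones for the boundary barrier, large positive ones at isolated minima.\<close>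

lemma modified_det_mat_neg:
  assumes "modified_det detp" "c < 0"
  shows "detp (mat c :: real^'n^'n) < 0"
  using assms not_psd_mat[where 'n='n, OF assms(2)] mat_in_sym_matrices[of c, where 'n='n]
  unfolding modified_det_def by metis

lemma modified_det_mat_nonneg:
  assumes "modified_det detp" "0 \<le> c"
  shows "detp (mat c :: real^'n^'n) = c ^ CARD('n)"
  using assms psd_mat[where 'n='n, OF assms(2)] mat_in_sym_matrices[of c, where 'n='n]
  unfolding modified_det_def det_mat_power[symmetric] by metis

section \<open>Derivatives along lines and Schwarz's theorem\<close>

lemma C2_closure_imp_line_deriv:
  assumes C2: "C2_closure \<Omega> \<phi> G H" and x: "x + t *\<^sub>R v \<in> \<Omega>"
  shows "((\<lambda>t. \<phi> (x + t *\<^sub>R v)) has_real_derivative (G (x + t *\<^sub>R v) \<bullet> v)) (at t)"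
    and "((\<lambda>t. G (x + t *\<^sub>R v) \<bullet> w) has_real_derivative (w \<bullet> (H (x + t *\<^sub>R v) *v v))) (at t)"
proof -
  have line: "((\<lambda>t. x + t *\<^sub>R v) has_derivative (\<lambda>s. s *\<^sub>R v)) (at t)"
    by (auto intro!: derivative_eq_intros)
  have g: "(\<phi> has_derivative (\<lambda>h. h \<bullet> G (x + t *\<^sub>R v))) (at (x + t *\<^sub>R v))"
   and h: "(G has_derivative (\<lambda>h. H (x + t *\<^sub>R v) *v h)) (at (x + t *\<^sub>R v))"
    using C2 x by (auto simp: C2_closure_def gderiv_def)
  have "((\<lambda>t. \<phi> (x + t *\<^sub>R v)) has_derivative (\<lambda>s. (s *\<^sub>R v) \<bullet> G (x + t *\<^sub>R v))) (at t)"
    using has_derivative_compose[OF line g] by simp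
  then show "((\<lambda>t. \<phi> (x + t *\<^sub>R v)) has_real_derivative (G (x + t *\<^sub>R v) \<bullet> v)) (at t)"
    by (simp add: has_field_derivative_def inner_commute mult_commute_abs)
  have "((\<lambda>t. G (x + t *\<^sub>R v)) has_derivative (\<lambda>s. H (x + t *\<^sub>R v) *v (s *\<^sub>R v))) (at t)"
    using has_derivative_compose[OF line h] by simp
  then have "((\<lambda>t. G (x + t *\<^sub>R v) \<bullet> w) has_derivative (\<lambda>s. (H (x + t *\<^sub>R v) *v (s *\<^sub>R v)) \<bullet> w)) (at t)"
    by (rule has_derivative_inner_left)
  then show "((\<lambda>t. G (x + t *\<^sub>R v) \<bullet> w) has_real_derivative (w \<bullet> (H (x + t *\<^sub>R v) *v v))) (at t)"
    by (simp add: has_field_derivative_def inner_commute matrix_vector_mult_scaleR mult.commute[of _ "_ \<bullet> _"])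
qed

text \<open>The second difference of \<open>\<phi>\<close> in the directions \<open>v\<close> and \<open>w\<close> is symmetric in them.\<close>

lemma second_difference_mean_value:
  assumes C2: "C2_closure \<Omega> \<phi> G H" and "0 < t"
    and sub: "cball x (t * (norm v + norm w)) \<subseteq> \<Omega>"
  obtains \<xi> where "\<xi> \<in> cball x (t * (norm v + norm w))"
    "\<phi> (x + t *\<^sub>R v + t *\<^sub>R w) - \<phi> (x + t *\<^sub>R v) - \<phi> (x + t *\<^sub>R w) + \<phi> x
       = t\<^sup>2 * (v \<bullet> (H \<xi> *v w))"
proof -
  have inball: "x + r *\<^sub>R v + s *\<^sub>R w \<in> cball x (t * (norm v + norm w))"
    if "0 \<le> r" "r \<le> t" "0 \<le> s" "s \<le> t" for r s
  proof -
    have "norm (r *\<^sub>R v + s *\<^sub>R w) \<le> r * norm v + s * norm w"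
      using norm_triangle_ineq[of "r *\<^sub>R v" "s *\<^sub>R w"] that by simp
    also have "\<dots> \<le> t * norm v + t * norm w"
      using that by (intro add_mono mult_right_mono) auto
    finally show ?thesis
      using norm_minus_cancel[of "r *\<^sub>R v + s *\<^sub>R w"]
      by (simp add: dist_norm algebra_simps)
  qed
  \<comment> \<open>Here \<open>p t - p 0\<close> is the second difference: the increment along
    \<open>v\<close> of the increment along \<open>w\<close>.\<close>
  define p where "p s = \<phi> ((x + t *\<^sub>R w) + s *\<^sub>R v) - \<phi> (x + s *\<^sub>R v)" for s
  have dp: "(p has_real_derivative (G ((x + t *\<^sub>R w) + s *\<^sub>R v) \<bullet> v - G (x + s *\<^sub>R v) \<bullet> v)) (at s)"
    if "0 \<le> s" "s \<le> t" for s
    unfolding p_def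
  proof (rule DERIV_diff; rule C2_closure_imp_line_deriv[OF C2])
    show "x + t *\<^sub>R w + s *\<^sub>R v \<in> \<Omega>"
      using inball[of s t] that sub \<open>0 < t\<close> by (auto simp: algebra_simps)
    show "x + s *\<^sub>R v \<in> \<Omega>"
      using inball[of s 0] that sub \<open>0 < t\<close> by (auto simp: algebra_simps)
  qed
  obtain s where s: "0 < s" "s < t" and
    ps: "p t - p 0 = (t - 0) * (G ((x + t *\<^sub>R w) + s *\<^sub>R v) \<bullet> v - G (x + s *\<^sub>R v) \<bullet> v)"
    using MVT2[of 0 t p "\<lambda>s. G ((x + t *\<^sub>R w) + s *\<^sub>R v) \<bullet> v - G (x + s *\<^sub>R v) \<bullet> v"] dp \<open>0 < t\<close> by blast
  \<comment> \<open>The first mean value step leaves a difference of directional derivatives at two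
    points that differ by t w. This is \<open>q t - q 0\<close>, ready for a second mean value step
    along \<open>w\<close>.\<close>
  define q where "q r = G ((x + s *\<^sub>R v) + r *\<^sub>R w) \<bullet> v" for r
  have dq: "(q has_real_derivative (v \<bullet> (H ((x + s *\<^sub>R v) + r *\<^sub>R w) *v w))) (at r)"
    if "0 \<le> r" "r \<le> t" for r
    unfolding q_def
  proof (rule C2_closure_imp_line_deriv[OF C2])
    show "x + s *\<^sub>R v + r *\<^sub>R w \<in> \<Omega>"
      using inball[of s r] that sub s by auto
  qed
  obtain r where r: "0 < r" "r < t" and
    qr: "q t - q 0 = (t - 0) * (v \<bullet> (H ((x + s *\<^sub>R v) + r *\<^sub>R w) *v w))"
    using MVT2[of 0 t q "\<lambda>r. v \<bullet> (H ((x + s *\<^sub>R v) + r *\<^sub>R w) *v w)"] dq \<open>0 < t\<close> by blast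
  show ?thesis
  proof
    show "x + s *\<^sub>R v + r *\<^sub>R w \<in> cball x (t * (norm v + norm w))"
      using inball[of s r] s r by auto
    have "p t - p 0 = t * (q t - q 0)"
      using ps by (simp add: q_def algebra_simps)
    then show "\<phi> (x + t *\<^sub>R v + t *\<^sub>R w) - \<phi> (x + t *\<^sub>R v) - \<phi> (x + t *\<^sub>R w) + \<phi> x
       = t\<^sup>2 * (v \<bullet> (H (x + s *\<^sub>R v + r *\<^sub>R w) *v w))"
      using qr by (simp add: p_def power2_eq_square add_ac diff_diff_eq)
  qed
qed

text \<open>In the interior, the same second difference is evaluated in both orders on balls that
  shrink to a point. On the boundary, symmetry passes to the continuous extension of the
  Hessian.\<close>

lemma C2_closure_hessian_sym:
  assumes "open \<Omega>" and C2: "C2_closure \<Omega> \<phi> G H" and x: "x \<in> closure \<Omega>"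
  shows "H x \<in> sym_matrices"
proof (rule sym_matricesI)
  fix v w
  have cont: "continuous_on (closure \<Omega>) (\<lambda>z. a \<bullet> (H z *v b))" for a b
    using C2 unfolding C2_closure_def by (intro continuous_intros continuous_on_matrix_vector_mult) auto
  have inner: "v \<bullet> (H z *v w) = w \<bullet> (H z *v v)" if z: "z \<in> \<Omega>" for z
  proof (rule ccontr)
    assume neq: "v \<bullet> (H z *v w) \<noteq> w \<bullet> (H z *v v)"
    \<comment> \<open>Half of the supposed gap: a common value cannot be strictly within e of both
      limits.\<close>
    define e where "e = \<bar>v \<bullet> (H z *v w) - w \<bullet> (H z *v v)\<bar> / 2"
    have "e > 0" using neq by (simp add: e_def)
    have "z \<in> interior (closure \<Omega>)"
      using z \<open>open \<Omega>\<close> by (intro interiorI[of \<Omega>] closure_subset)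
    then have tends: "((\<lambda>z. a \<bullet> (H z *v b)) \<longlongrightarrow> a \<bullet> (H z *v b)) (nhds z)" for a b
      using continuous_on_interior[OF cont]
        tendsto_at_iff_tendsto_nhds[of "\<lambda>z. a \<bullet> (H z *v b)" z]
      unfolding isCont_def by blast
    have near: "\<forall>\<^sub>F y in nhds z. dist (a \<bullet> (H y *v b)) (a \<bullet> (H z *v b)) < e" for a b
      by (rule tendstoD[OF tends \<open>e > 0\<close>])
    have "\<forall>\<^sub>F y in nhds z. y \<in> \<Omega>"
      using \<open>open \<Omega>\<close> z by (rule eventually_nhds_in_open)
    then have "\<forall>\<^sub>F y in nhds z. y \<in> \<Omega> \<and> dist (v \<bullet> (H y *v w)) (v \<bullet> (H z *v w)) < e \<and>
        dist (w \<bullet> (H y *v v)) (w \<bullet> (H z *v v)) < e"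
      by (intro eventually_conj near)
    then obtain d where "d > 0" and d: "\<And>y. dist y z < d \<Longrightarrow> y \<in> \<Omega> \<and>
        dist (v \<bullet> (H y *v w)) (v \<bullet> (H z *v w)) < e \<and> dist (w \<bullet> (H y *v v)) (w \<bullet> (H z *v v)) < e"
      unfolding eventually_nhds_metric by blast
    \<comment> \<open>The summand 1 keeps the divisor positive when v = w = 0; all points of the
      second difference then stay within d/2 of z.\<close>
    define s where "s = norm v + norm w + 1"
    define t where "t = d / 2 / s"
    have "s > 0"
      by (simp add: s_def add_nonneg_pos)
    then have "t > 0"
      using \<open>d > 0\<close> by (simp add: t_def)
    then have "t * (norm v + norm w) \<le> t * s"
      by (simp add: s_def)
    also have "\<dots> < d"
      using \<open>s > 0\<close> \<open>d > 0\<close> by (simp add: t_def)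
    finally have "t * (norm v + norm w) < d" .
    then have dd: "y \<in> \<Omega> \<and> dist (v \<bullet> (H y *v w)) (v \<bullet> (H z *v w)) < e \<and>
        dist (w \<bullet> (H y *v v)) (w \<bullet> (H z *v v)) < e" if "y \<in> cball z (t * (norm v + norm w))" for y
      using d[of y] that by (simp add: dist_commute)
    obtain \<xi> where \<xi>: "\<xi> \<in> cball z (t * (norm v + norm w))"
      "\<phi> (z + t *\<^sub>R v + t *\<^sub>R w) - \<phi> (z + t *\<^sub>R v) - \<phi> (z + t *\<^sub>R w) + \<phi> z = t\<^sup>2 * (v \<bullet> (H \<xi> *v w))"
      using second_difference_mean_value[OF C2 \<open>t > 0\<close>] dd by (metis subsetI)
    obtain \<eta> where \<eta>: "\<eta> \<in> cball z (t * (norm w + norm v))"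
      "\<phi> (z + t *\<^sub>R w + t *\<^sub>R v) - \<phi> (z + t *\<^sub>R w) - \<phi> (z + t *\<^sub>R v) + \<phi> z = t\<^sup>2 * (w \<bullet> (H \<eta> *v v))"
      using second_difference_mean_value[OF C2 \<open>t > 0\<close>, of z w v] dd by (metis add.commute subsetI)
    have "t\<^sup>2 * (v \<bullet> (H \<xi> *v w)) = t\<^sup>2 * (w \<bullet> (H \<eta> *v v))"
      unfolding \<xi>(2)[symmetric] \<eta>(2)[symmetric] by (simp add: add_ac)
    then have "v \<bullet> (H \<xi> *v w) = w \<bullet> (H \<eta> *v v)"
      using \<open>t > 0\<close> by simp
    moreover have "dist (v \<bullet> (H \<xi> *v w)) (v \<bullet> (H z *v w)) < e"
      using dd \<xi>(1) by blast
    moreover have "dist (w \<bullet> (H \<eta> *v v)) (w \<bullet> (H z *v v)) < e"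
      using dd \<eta>(1) by (metis add.commute)
    ultimately show False
      by (simp add: e_def dist_real_def) argo
  qed
  show "v \<bullet> (H x *v w) = w \<bullet> (H x *v v)"
    using continuous_constant_on_closure[of \<Omega> "\<lambda>z. v \<bullet> (H z *v w) - w \<bullet> (H z *v v)" 0 x]
      cont inner x by (simp add: continuous_on_diff)
qed

section \<open>Test functions\<close>

text \<open>The product rule multiplies a derivative of one factor by the other factor itself, so
  the induction for products has to lower the order of the factors.\<close>

lemma Ck_closure_Suc_imp: "Ck_closure (Suc k) \<Omega> a \<Longrightarrow> Ck_closure k \<Omega> a"
  by (induction k arbitrary: a) auto

lemma Ck_closure_const: "Ck_closure k \<Omega> (\<lambda>x. c)"
proof (induction k arbitrary: c)
  case (Suc k)
  have "\<forall>x\<in>\<Omega>. GDERIV (\<lambda>x. c) x :> 0"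
    by (simp add: GDERIV_const)
  moreover have "\<forall>i. Ck_closure k \<Omega> (\<lambda>x. (0::real^'a) $ i)"
    using Suc by simp
  ultimately show ?case
    by (auto intro!: exI[of _ "\<lambda>x. 0"])
qed simp

lemma Ck_closure_inner: "Ck_closure k \<Omega> (\<lambda>x. b \<bullet> x)"
proof (cases k)
  case (Suc j)
  have "\<forall>x\<in>\<Omega>. GDERIV (\<lambda>x. b \<bullet> x) x :> b"
    by (auto simp: gderiv_def inner_commute[of b] intro!: derivative_eq_intros)
  then show ?thesis
    unfolding Suc by (auto intro!: exI[of _ "\<lambda>x. b"] continuous_intros Ck_closure_const)
qed (auto intro!: continuous_intros)

lemma Ck_closure_add:
  "Ck_closure k \<Omega> a \<Longrightarrow> Ck_closure k \<Omega> b \<Longrightarrow> Ck_closure k \<Omega> (\<lambda>x. a x + b x)"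
proof (induction k arbitrary: a b)
  case (Suc k)
  then obtain A B where A: "\<forall>x\<in>\<Omega>. GDERIV a x :> A x" "\<forall>i. Ck_closure k \<Omega> (\<lambda>x. A x $ i)"
    and B: "\<forall>x\<in>\<Omega>. GDERIV b x :> B x" "\<forall>i. Ck_closure k \<Omega> (\<lambda>x. B x $ i)"
    by auto
  have "\<forall>x\<in>\<Omega>. GDERIV (\<lambda>x. a x + b x) x :> A x + B x"
    using A B by (auto intro: GDERIV_add)
  moreover have "\<forall>i. Ck_closure k \<Omega> (\<lambda>x. (A x + B x) $ i)"
    using Suc.IH A B by simp
  ultimately show ?case
    using Suc.prems by (auto intro!: continuous_intros exI[of _ "\<lambda>x. A x + B x"])
qed (auto intro!: continuous_intros)

lemma Ck_closure_mult:
  "Ck_closure k \<Omega> a \<Longrightarrow> Ck_closure k \<Omega> b \<Longrightarrow> Ck_closure k \<Omega> (\<lambda>x. a x * b x)"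
proof (induction k arbitrary: a b)
  case (Suc k)
  then obtain A B where A: "\<forall>x\<in>\<Omega>. GDERIV a x :> A x" "\<forall>i. Ck_closure k \<Omega> (\<lambda>x. A x $ i)"
    and B: "\<forall>x\<in>\<Omega>. GDERIV b x :> B x" "\<forall>i. Ck_closure k \<Omega> (\<lambda>x. B x $ i)"
    by auto
  have "\<forall>x\<in>\<Omega>. GDERIV (\<lambda>x. a x * b x) x :> a x *\<^sub>R B x + b x *\<^sub>R A x"
    using A B by (auto intro: GDERIV_mult)
  moreover have "\<forall>i. Ck_closure k \<Omega> (\<lambda>x. (a x *\<^sub>R B x + b x *\<^sub>R A x) $ i)"
    using Suc.IH A B Suc.prems[THEN Ck_closure_Suc_imp] by (simp add: Ck_closure_add)
  ultimately show ?case
    using Suc.prems by (auto intro!: continuous_intros exI[of _ "\<lambda>x. a x *\<^sub>R B x + b x *\<^sub>R A x"])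
qed (auto intro!: continuous_intros)

lemma smooth_closure_const: "smooth_closure \<Omega> (\<lambda>x. c)"
  and smooth_closure_inner_left: "smooth_closure \<Omega> (\<lambda>x. b \<bullet> x)"
  and smooth_closure_add:
    "smooth_closure \<Omega> a \<Longrightarrow> smooth_closure \<Omega> a' \<Longrightarrow> smooth_closure \<Omega> (\<lambda>x. a x + a' x)"
  and smooth_closure_mult:
    "smooth_closure \<Omega> a \<Longrightarrow> smooth_closure \<Omega> a' \<Longrightarrow> smooth_closure \<Omega> (\<lambda>x. a x * a' x)"
  by (simp_all add: smooth_closure_def Ck_closure_const Ck_closure_inner Ck_closure_add Ck_closure_mult)

lemma smooth_closure_uminus: "smooth_closure \<Omega> a \<Longrightarrow> smooth_closure \<Omega> (\<lambda>x. - a x)"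
  using smooth_closure_mult[OF smooth_closure_const[of \<Omega> "-1"]] by simp

lemma smooth_closure_sum:
  "finite I \<Longrightarrow> (\<And>i. i \<in> I \<Longrightarrow> smooth_closure \<Omega> (a i)) \<Longrightarrow> smooth_closure \<Omega> (\<lambda>x. \<Sum>i\<in>I. a i x)"
  by (induction I rule: finite_induct) (simp_all add: smooth_closure_const smooth_closure_add)

lemma smooth_closure_quadratic_form:
  "smooth_closure \<Omega> (\<lambda>x. (x - x0) \<bullet> (A *v (x - x0)))"
proof -
  have "smooth_closure \<Omega> (\<lambda>x. \<Sum>i\<in>UNIV. (x - x0) $ i * (A *v (x - x0)) $ i)"
  proof (intro smooth_closure_sum smooth_closure_mult)
    fix i
    have "(\<lambda>x. (x - x0) $ i) = (\<lambda>x. axis i 1 \<bullet> x + - x0 $ i)"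
      by (simp add: inner_axis')
    then show "smooth_closure \<Omega> (\<lambda>x. (x - x0) $ i)"
      using smooth_closure_add[OF smooth_closure_inner_left smooth_closure_const] by metis
    have "(\<lambda>x. (A *v (x - x0)) $ i) = (\<lambda>x. (A $ i) \<bullet> x + - (A $ i \<bullet> x0))"
      by (simp add: matrix_vector_mul_component inner_diff_right)
    then show "smooth_closure \<Omega> (\<lambda>x. (A *v (x - x0)) $ i)"
      using smooth_closure_add[OF smooth_closure_inner_left smooth_closure_const] by metis
  qed simp
  then show ?thesis
    by (simp add: inner_vec_def)
qed

text \<open>The quartic term is invisible at \<open>x0\<close> to second order and turns local extrema into global ones.\<close>

definition quartic where
  "quartic x0 c p A C x = c + p \<bullet> (x - x0) + 1 / 2 * ((x - x0) \<bullet> (A *v (x - x0)))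
     + C * ((x - x0) \<bullet> (x - x0))\<^sup>2"

definition quartic_grad where
  "quartic_grad x0 p A C x = p + A *v (x - x0) + (4 * C * ((x - x0) \<bullet> (x - x0))) *\<^sub>R (x - x0)"

definition outer :: "real^'n \<Rightarrow> real^'n^'n" where
  "outer w = (\<chi> i j. w $ i * w $ j)"

lemma outer_mult: "outer w *v v = (w \<bullet> v) *\<^sub>R w"
  by (simp add: outer_def vec_eq_iff matrix_vector_mult_def inner_vec_def sum_distrib_right sum_distrib_left mult_ac)

text \<open>With w = x - x0, the gradient of C |w|^4 is 4 C |w|^2 w, whose derivative is 4 C (|w|^2
  I + 2 w w^T).\<close>

definition quartic_hess where
  "quartic_hess x0 A C x = A + (4 * C * ((x - x0) \<bullet> (x - x0))) *\<^sub>R mat 1 + (8 * C) *\<^sub>R outer (x - x0)"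

lemma quartic_center [simp]:
  "quartic x0 c p A C x0 = c" "quartic_grad x0 p A C x0 = p" "quartic_hess x0 A C x0 = A"
  by (simp_all add: quartic_def quartic_grad_def quartic_hess_def outer_def zero_vec_def[symmetric])

lemma smooth_closure_quartic: "smooth_closure \<Omega> (quartic x0 c p A C)"
proof -
  \<comment> \<open>The squared distance is written as the quadratic form of \<open>mat 1\<close>,
    so that one lemma on quadratic forms also covers the quartic term.\<close>
  have "smooth_closure \<Omega> (\<lambda>x. (c - p \<bullet> x0) + p \<bullet> x + ((1/2) * ((x - x0) \<bullet> (A *v (x - x0)))
     + C * (((x - x0) \<bullet> (mat 1 *v (x - x0))) * ((x - x0) \<bullet> (mat 1 *v (x - x0))))))"
    by (intro smooth_closure_add smooth_closure_mult smooth_closure_const smooth_closure_inner_left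
        smooth_closure_quadratic_form)
  moreover have "(\<lambda>x. (c - p \<bullet> x0) + p \<bullet> x + ((1/2) * ((x - x0) \<bullet> (A *v (x - x0)))
     + C * (((x - x0) \<bullet> (mat 1 *v (x - x0))) * ((x - x0) \<bullet> (mat 1 *v (x - x0)))))) = quartic x0 c p A C"
    by (simp add: fun_eq_iff quartic_def power2_eq_square inner_diff_right)
  ultimately show ?thesis
    by simp
qed

text \<open>For general \<open>A\<close> the Hessian of half the quadratic form is the symmetric
  part of \<open>A\<close>; symmetry makes it \<open>A\<close> itself.\<close>

lemma C2_closure_quartic:
  assumes "A \<in> sym_matrices"
  shows "C2_closure \<Omega> (quartic x0 c p A C) (quartic_grad x0 p A C) (quartic_hess x0 A C)"
proof -
  have shift: "((\<lambda>x. x - x0) has_derivative (\<lambda>h. h)) (at x)" for x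
    by (auto intro!: derivative_eq_intros)
  have Ad: "((\<lambda>x. A *v (x - x0)) has_derivative (\<lambda>h. A *v h)) (at x)" for x
    by (rule bounded_linear.has_derivative[OF matrix_vector_mul_bounded_linear shift])
  have sq: "((\<lambda>x. (x - x0) \<bullet> (x - x0)) has_derivative (\<lambda>h. 2 * ((x - x0) \<bullet> h))) (at x)" for x
    using has_derivative_inner[OF shift shift] by (simp add: inner_commute)
  have form: "((\<lambda>x. (x - x0) \<bullet> (A *v (x - x0))) has_derivative (\<lambda>h. 2 * (h \<bullet> (A *v (x - x0))))) (at x)" for x
    using has_derivative_inner[OF shift[of x] Ad[of x]] by (simp add: matrix_inner_commute[OF assms, of "x - x0"])
  have "GDERIV (quartic x0 c p A C) x :> quartic_grad x0 p A C x" for x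
  proof -
    have "(quartic x0 c p A C has_derivative (\<lambda>h. 0 + p \<bullet> h + 1 / 2 * (2 * (h \<bullet> (A *v (x - x0))))
        + C * (of_nat 2 * (2 * ((x - x0) \<bullet> h)) * ((x - x0) \<bullet> (x - x0)) ^ (2 - 1)))) (at x)"
      unfolding quartic_def[abs_def]
      by (intro has_derivative_add has_derivative_const has_derivative_mult_right form
          has_derivative_inner_right shift has_derivative_power sq)
    then show ?thesis
      unfolding gderiv_def
      by (rule has_derivative_subst)
        (simp add: fun_eq_iff quartic_grad_def inner_add_right inner_commute)
  qed
  moreover have "(quartic_grad x0 p A C has_derivative (\<lambda>v. quartic_hess x0 A C x *v v)) (at x)" for x
  proof -
    have "(quartic_grad x0 p A C has_derivative (\<lambda>h. 0 + A *v h
        + ((4 * C * ((x - x0) \<bullet> (x - x0))) *\<^sub>R h + (4 * C * (2 * ((x - x0) \<bullet> h))) *\<^sub>R (x - x0)))) (at x)"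
      unfolding quartic_grad_def[abs_def]
      by (intro has_derivative_add has_derivative_const has_derivative_scaleR has_derivative_mult_right
          sq shift Ad)
    then show ?thesis
      by (rule has_derivative_subst)
        (simp add: fun_eq_iff quartic_hess_def outer_mult matrix_vector_mult_add_rdistrib
          flip: scaleR_matrix_vector_assoc)
  qed
  moreover have "continuous_on (closure \<Omega>) (quartic_hess x0 A C)"
    unfolding quartic_hess_def outer_def
    by (intro continuous_on_add continuous_on_scaleR continuous_on_vec_lambda continuous_on_mult
        continuous_on_inner continuous_on_const continuous_on_component continuous_on_diff continuous_on_id)
  moreover have "continuous_on (closure \<Omega>) (quartic x0 c p A C)"
    unfolding quartic_def by (intro continuous_intros continuous_on_matrix_vector_mult)
  moreover have "continuous_on (closure \<Omega>) (quartic_grad x0 p A C)"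
    unfolding quartic_grad_def by (intro continuous_intros continuous_on_matrix_vector_mult)
  ultimately show ?thesis
    unfolding C2_closure_def by blast
qed

lemma C2_closure_uminus:
  assumes "C2_closure \<Omega> \<phi> G H"
  shows "C2_closure \<Omega> (\<lambda>x. - \<phi> x) (\<lambda>x. - G x) (\<lambda>x. - H x)"
proof -
  have neg: "(- A) *v v = - (A *v v)" for A :: "real^'n^'n" and v
    by (simp add: matrix_vector_mult_def vec_eq_iff sum_negf)
  have "((\<lambda>x. - G x) has_derivative (\<lambda>v. (- H x) *v v)) (at x)"
    if "(G has_derivative (\<lambda>v. H x *v v)) (at x)" for x
    unfolding neg by (rule has_derivative_minus[OF that])
  then show ?thesis
    using assms by (auto simp: C2_closure_def intro!: continuous_intros GDERIV_minus)
qed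

section \<open>Taylor bounds up to the boundary and global test functions\<close>

text \<open>At a boundary point there is no derivative in a full neighbourhood to expand. For
  \<open>y\<close> in the open set, however, convexity puts the segment from \<open>x0\<close> to
  \<open>y\<close>, except possibly \<open>x0\<close>, inside \<Omega>, where the one-variable
  calculus applies; the remaining \<open>y\<close> follow by continuity.\<close>

lemma C2_closure_taylor_upper:
  fixes \<Omega> :: "(real^'n) set"
  assumes "open \<Omega>" "convex \<Omega>" and C2: "C2_closure \<Omega> \<phi> G H"
    and x0: "x0 \<in> closure \<Omega>" and "0 < \<epsilon>"
  obtains r where "r > 0" "\<And>y. y \<in> closure \<Omega> \<Longrightarrow> dist y x0 < r \<Longrightarrow>
    \<phi> y \<le> \<phi> x0 + G x0 \<bullet> (y - x0) + ((y - x0) \<bullet> (H x0 *v (y - x0)) + \<epsilon> * ((y - x0) \<bullet> (y - x0))) / 2"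
proof -
  obtain B where "B > 0" and B: "\<And>A v. norm ((A::real^'n^'n) *v (v::real^'n)) \<le> norm A * norm v * B"
    using bounded_bilinear.pos_bounded[OF bounded_bilinear_matrix_vector_mult] by blast
  have conts: "continuous_on (closure \<Omega>) H" "continuous_on (closure \<Omega>) G" "continuous_on (closure \<Omega>) \<phi>"
    using C2 by (auto simp: C2_closure_def)
  \<comment> \<open>Dividing by \<open>B\<close> cancels the constant in the bound for the
    matrix-vector product.\<close>
  have "\<epsilon> / B > 0"
    using \<open>0 < \<epsilon>\<close> \<open>B > 0\<close> by simp
  then obtain r where "r > 0" and r: "\<And>y. y \<in> closure \<Omega> \<Longrightarrow> dist y x0 < r \<Longrightarrow> dist (H y) (H x0) < \<epsilon> / B"
    using conts(1) x0 unfolding continuous_on_iff by blast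
  have H: "w \<bullet> (H y *v w) \<le> w \<bullet> (H x0 *v w) + \<epsilon> * (w \<bullet> w)" if "y \<in> closure \<Omega>" "dist y x0 < r" for y w
  proof -
    have "w \<bullet> (H y *v w) - w \<bullet> (H x0 *v w) = w \<bullet> ((H y - H x0) *v w)"
      by (simp add: matrix_vector_mult_diff_rdistrib inner_diff_right)
    also have "\<dots> \<le> norm w * norm ((H y - H x0) *v w)"
      by (rule norm_cauchy_schwarz)
    also have "\<dots> \<le> norm w * (norm (H y - H x0) * norm w * B)"
      by (intro mult_left_mono B) auto
    also have "\<dots> \<le> norm w * (\<epsilon> / B * norm w * B)"
      using r[OF that] \<open>B > 0\<close> by (intro mult_left_mono mult_right_mono) (auto simp: dist_norm)
    also have "\<dots> = \<epsilon> * (w \<bullet> w)"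
      using \<open>B > 0\<close> by (simp add: dot_square_norm power2_eq_square)
    finally show ?thesis by simp
  qed
  define Q where "Q y = \<phi> x0 + G x0 \<bullet> (y - x0) + ((y - x0) \<bullet> (H x0 *v (y - x0)) + \<epsilon> * ((y - x0) \<bullet> (y - x0))) / 2" for y
  have inside: "\<phi> y \<le> Q y" if y: "y \<in> \<Omega> \<inter> ball x0 r" for y
  proof -
    define w where "w = y - x0"
    have seg: "x0 + t *\<^sub>R w \<in> \<Omega>" if "0 < t" "t \<le> 1" for t
    proof (cases "t = 1 \<or> y = x0")
      case True
      then show ?thesis using y by (auto simp: w_def)
    next
      case False
      then have "x0 + t *\<^sub>R w \<in> open_segment y x0"
        using that by (auto simp: in_segment w_def algebra_simps intro!: exI[of _ "1 - t"])
      then show ?thesis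
        using in_interior_closure_convex_segment[OF \<open>convex \<Omega>\<close> _ x0, of y] y \<open>open \<Omega>\<close>
        by (auto simp: interior_open)
    qed
    then have segc: "x0 + t *\<^sub>R w \<in> closure \<Omega>" if "0 \<le> t" "t \<le> 1" for t
      using that x0 closure_subset[of \<Omega>] by (cases "t = 0") auto
    have segr: "dist (x0 + t *\<^sub>R w) x0 < r" if "0 \<le> t" "t \<le> 1" for t
    proof -
      have "t * norm w \<le> 1 * norm w"
        using that by (intro mult_right_mono) auto
      then show ?thesis
        using y that by (simp add: dist_norm w_def norm_minus_commute)
    qed
    have lin: "continuous_on {0..b} (\<lambda>t. x0 + t *\<^sub>R w)" for b :: real
      by (intro continuous_intros)
    have Gc: "continuous_on {0..b} (\<lambda>t. G (x0 + t *\<^sub>R w))" if "b \<le> 1" for b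
      using that segc
      by (intro continuous_on_compose2[OF \<open>continuous_on (closure \<Omega>) G\<close> lin]) auto
    have \<phi>c: "continuous_on {0..b} (\<lambda>t. \<phi> (x0 + t *\<^sub>R w))" if "b \<le> 1" for b
      using that segc
      by (intro continuous_on_compose2[OF \<open>continuous_on (closure \<Omega>) \<phi>\<close> lin]) auto
    define m where "m = w \<bullet> (H x0 *v w) + \<epsilon> * (w \<bullet> w)"
    have grad: "G (x0 + t *\<^sub>R w) \<bullet> w \<le> G x0 \<bullet> w + t * m" if t: "0 < t" "t \<le> 1" for t
    proof -
      \<comment> \<open>The Hessian bound is integrated once along the segment, as monotonicity of
        \<open>q\<close>, and once more below, as monotonicity of \<open>p\<close>.\<close>
      define q where "q s = G (x0 + s *\<^sub>R w) \<bullet> w - s * m" for s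
      have "q 0 \<ge> q t"
      proof (rule DERIV_nonpos_imp_decreasing_open[where f=q])
        fix s assume s: "0 < s" "s < t"
        have "(q has_real_derivative (w \<bullet> (H (x0 + s *\<^sub>R w) *v w) - m)) (at s)"
          unfolding q_def using C2_closure_imp_line_deriv(2)[OF C2 seg, of s w] s t
          by (auto intro!: derivative_eq_intros)
        moreover have "w \<bullet> (H (x0 + s *\<^sub>R w) *v w) - m \<le> 0"
          using H[OF segc segr, of s w] s t by (simp add: m_def)
        ultimately show "\<exists>y. (q has_real_derivative y) (at s) \<and> y \<le> 0"
          by blast
      qed (use t Gc in \<open>auto simp: q_def intro!: continuous_intros\<close>)
      then show ?thesis by (simp add: q_def)
    qed
    define p where "p t = \<phi> (x0 + t *\<^sub>R w) - t * (G x0 \<bullet> w) - t\<^sup>2 / 2 * m" for t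
    have "p 0 \<ge> p 1"
    proof (rule DERIV_nonpos_imp_decreasing_open[where f=p])
      fix t :: real assume t: "0 < t" "t < 1"
      have "(p has_real_derivative (G (x0 + t *\<^sub>R w) \<bullet> w - G x0 \<bullet> w - t * m)) (at t)"
        unfolding p_def using C2_closure_imp_line_deriv(1)[OF C2 seg, of t] t
        by (auto intro!: derivative_eq_intros)
      moreover have "G (x0 + t *\<^sub>R w) \<bullet> w - G x0 \<bullet> w - t * m \<le> 0"
        using grad[of t] t by simp
      ultimately show "\<exists>y. (p has_real_derivative y) (at t) \<and> y \<le> 0"
        by blast
    qed (use \<phi>c in \<open>auto simp: p_def intro!: continuous_intros\<close>)
    then show ?thesis
      by (simp add: p_def Q_def m_def w_def)
  qed
  have "\<phi> y \<le> Q y" if y: "y \<in> closure \<Omega>" "dist y x0 < r" for y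
  proof -
    \<comment> \<open>The ball is open, so \<open>y\<close> can be approached from \<Omega> without
      leaving it.\<close>
    have "y \<in> closure (\<Omega> \<inter> ball x0 r)"
      using y open_Int_closure_subset[of "ball x0 r" \<Omega>] by (auto simp: dist_commute Int_commute)
    moreover have "continuous_on (closure (\<Omega> \<inter> ball x0 r)) (\<lambda>y. \<phi> y - Q y)"
      unfolding Q_def using \<open>continuous_on (closure \<Omega>) \<phi>\<close> closure_mono[of "\<Omega> \<inter> ball x0 r" \<Omega>]
      by (intro continuous_intros continuous_on_matrix_vector_mult) (auto intro: continuous_on_subset)
    ultimately have "\<phi> y - Q y \<le> 0"
      using inside continuous_le_on_closure[of "\<Omega> \<inter> ball x0 r" "\<lambda>y. \<phi> y - Q y" y 0] by simp
    then show ?thesis by simp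
  qed
  then show ?thesis
    using that[OF \<open>r > 0\<close>] unfolding Q_def by blast
qed

text \<open>The shift \<open>mat (2 * \<epsilon>)\<close> of the Hessian contributes \<epsilon> |y -
  x0|^2. The Taylor error consumes half of this, and the other half is the quadratic gap that makes
  the contact strict. Away from \<open>x0\<close> a large \<open>C\<close> lifts the quartic above
  the bounded \<open>W\<close>.\<close>

lemma quartic_touches_from_above:
  assumes "open \<Omega>" "convex \<Omega>" "bounded \<Omega>" and C2: "C2_closure \<Omega> \<phi> G H"
    and x0: "x0 \<in> closure \<Omega>" and "0 < \<epsilon>"
    and max: "\<forall>\<^sub>F y in at x0 within closure \<Omega>. W y - \<phi> y \<le> W x0 - \<phi> x0"
    and bound: "\<And>y. y \<in> closure \<Omega> \<Longrightarrow> W y \<le> B"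
  obtains C where "\<And>y. y \<in> closure \<Omega> \<Longrightarrow>
    W y + \<epsilon> / 2 * (dist y x0)\<^sup>2 \<le> quartic x0 (W x0) (G x0) (H x0 + mat (2 * \<epsilon>)) C y"
proof -
  let ?A = "H x0 + mat (2 * \<epsilon>)"
  obtain r1 where "r1 > 0" and r1: "\<And>y. y \<in> closure \<Omega> \<Longrightarrow> dist y x0 < r1 \<Longrightarrow>
    \<phi> y \<le> \<phi> x0 + G x0 \<bullet> (y - x0) + ((y - x0) \<bullet> (H x0 *v (y - x0)) + \<epsilon> * ((y - x0) \<bullet> (y - x0))) / 2"
    using C2_closure_taylor_upper[OF assms(1,2) C2 x0 \<open>0 < \<epsilon>\<close>] by metis
  obtain r2 where "r2 > 0" and r2: "\<And>y. y \<in> closure \<Omega> \<Longrightarrow> dist y x0 < r2 \<Longrightarrow> W y - \<phi> y \<le> W x0 - \<phi> x0"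
    using max unfolding eventually_at by (metis order_refl)
  define r where "r = min r1 r2"
  have "r > 0" using \<open>r1 > 0\<close> \<open>r2 > 0\<close> by (simp add: r_def)
  have expand: "quartic x0 (W x0) (G x0) ?A C y = W x0 + G x0 \<bullet> (y - x0)
      + (y - x0) \<bullet> (H x0 *v (y - x0)) / 2 + \<epsilon> * (dist y x0)\<^sup>2 + C * (dist y x0)^4" for C y
  proof -
    have "(y - x0) \<bullet> (y - x0) = (dist y x0)\<^sup>2"
      by (simp add: dist_norm power2_norm_eq_inner)
    then show ?thesis
      unfolding quartic_def matrix_vector_mult_add_rdistrib mat_mult_vector inner_add_right
      by (simp flip: power_mult)
  qed
  define R where "R y = \<epsilon> / 2 * (dist y x0)\<^sup>2 - quartic x0 (W x0) (G x0) ?A 0 y" for y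
  have "compact (closure \<Omega>)"
    using \<open>bounded \<Omega>\<close> by (simp add: compact_closure)
  moreover have "continuous_on (closure \<Omega>) R"
    unfolding R_def quartic_def by (intro continuous_intros continuous_on_matrix_vector_mult)
  ultimately obtain B' where B': "\<And>y. y \<in> closure \<Omega> \<Longrightarrow> R y \<le> B'"
    using continuous_attains_sup[of "closure \<Omega>" R] x0 by (metis empty_iff)
  \<comment> \<open>Already at distance r the quartic term equals the sum of the bounds for
    \<open>W\<close> and for the remaining terms \<open>R\<close>.\<close>
  define C where "C = (\<bar>B\<bar> + \<bar>B'\<bar>) / r^4"
  have "W y + \<epsilon> / 2 * (dist y x0)\<^sup>2 \<le> quartic x0 (W x0) (G x0) ?A C y" if y: "y \<in> closure \<Omega>" for y
  proof (cases "dist y x0 < r")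
    case True
    have "\<phi> y \<le> \<phi> x0 + G x0 \<bullet> (y - x0) + ((y - x0) \<bullet> (H x0 *v (y - x0)) + \<epsilon> * (dist y x0)\<^sup>2) / 2"
      using r1[OF y] True by (simp add: r_def dist_norm power2_norm_eq_inner)
    moreover have "W y - \<phi> y \<le> W x0 - \<phi> x0"
      using r2[OF y] True by (simp add: r_def)
    moreover have "0 \<le> C * (dist y x0)^4"
      using \<open>r > 0\<close> by (simp add: C_def)
    ultimately show ?thesis
      unfolding expand by (simp add: add_divide_distrib)
  next
    case False
    then have "r^4 \<le> (dist y x0)^4"
      using \<open>r > 0\<close> by (intro power_mono) auto
    then have "C * r^4 \<le> C * (dist y x0)^4"
      using \<open>r > 0\<close> by (intro mult_left_mono) (auto simp: C_def)
    moreover have "C * r^4 = \<bar>B\<bar> + \<bar>B'\<bar>"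
      using \<open>r > 0\<close> by (simp add: C_def)
    ultimately have "W y + R y \<le> C * (dist y x0)^4"
      using bound[OF y] B'[OF y] by linarith
    then show ?thesis
      by (simp add: R_def expand)
  qed
  then show ?thesis by (rule that)
qed

section \<open>Half-relaxed limits on grids\<close>

text \<open>A real number given by its cut properties, so that arithmetic with test functions stays
  in the reals. Lower limits are encoded as upper limits of the negated function.\<close>

definition is_limsup :: "'a filter \<Rightarrow> ('a \<Rightarrow> real) \<Rightarrow> real \<Rightarrow> bool" where
  "is_limsup \<F> w l \<longleftrightarrow> (\<forall>c>l. \<forall>\<^sub>F y in \<F>. w y < c) \<and> (\<forall>c<l. \<exists>\<^sub>F y in \<F>. c < w y)"

text \<open>The limit is the infimum of all eventual strict upper bounds; properness of the filter
  bounds that set from below.\<close>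

lemma is_limsup_exists:
  assumes "\<F> \<noteq> bot" and bound: "\<forall>\<^sub>F y in \<F>. \<bar>w y\<bar> \<le> M"
  obtains l where "is_limsup \<F> w l" "\<bar>l\<bar> \<le> M"
proof -
  define A where "A = {c. \<forall>\<^sub>F y in \<F>. w y < c}"
  have lower: "- M \<le> c" if "c \<in> A" for c
  proof -
    have "\<forall>\<^sub>F y in \<F>. w y < c \<and> \<bar>w y\<bar> \<le> M"
      using that bound by (auto simp: A_def intro: eventually_conj)
    then have "\<exists>y. w y < c \<and> \<bar>w y\<bar> \<le> M"
      using \<open>\<F> \<noteq> bot\<close> by (rule eventually_happens'[rotated])
    then show ?thesis by auto
  qed
  have upper: "c \<in> A" if "c > M" for c
    unfolding A_def using bound that by (auto elim!: eventually_mono)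
  have bdd: "bdd_below A"
    using lower by (auto simp: bdd_below_def)
  have "M + 1 \<in> A" by (rule upper) simp
  show ?thesis
  proof
    show "is_limsup \<F> w (Inf A)"
      unfolding is_limsup_def
    proof (intro conjI allI impI)
      fix c assume "Inf A < c"
      then obtain a where "a \<in> A" "a < c"
        using \<open>M + 1 \<in> A\<close> bdd by (metis cInf_less_iff empty_iff)
      then show "\<forall>\<^sub>F y in \<F>. w y < c"
        by (auto simp: A_def elim!: eventually_mono)
    next
      fix c assume c: "c < Inf A"
      show "\<exists>\<^sub>F y in \<F>. c < w y"
      proof (rule ccontr)
        assume "\<not> ?thesis"
        then have "\<forall>\<^sub>F y in \<F>. w y \<le> c"
          by (simp add: frequently_def not_less)
        \<comment> \<open>The midpoint turns a weak bound by c into a strict one that still lies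
          below the infimum.\<close>
        moreover have "v < (c + Inf A) / 2" if "v \<le> c" for v
          using that c by (simp add: field_simps)
        ultimately have "\<forall>\<^sub>F y in \<F>. w y < (c + Inf A) / 2"
          by (auto elim!: eventually_mono)
        then have "(c + Inf A) / 2 \<in> A"
          by (subst A_def) simp
        then have "Inf A \<le> (c + Inf A) / 2"
          using bdd by (rule cInf_lower)
        then show False using c by simp
      qed
    qed
    have "- M \<le> Inf A"
      using \<open>M + 1 \<in> A\<close> lower by (intro cInf_greatest) auto
    moreover have "Inf A \<le> c" if "c > M" for c
      using upper[OF that] bdd by (rule cInf_lower)
    then have "Inf A \<le> M"
      by (rule dense_ge)
    ultimately show "\<bar>Inf A\<bar> \<le> M" by simp
  qed
qed

lemma is_limsup_imp_Limsup:
  assumes "is_limsup \<F> w l"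
  shows "Limsup \<F> (\<lambda>y. ereal (w y)) = ereal l"
proof (rule antisym)
  show "Limsup \<F> (\<lambda>y. ereal (w y)) \<le> ereal l"
  proof (rule ccontr)
    assume "\<not> ?thesis"
    then obtain c where c: "ereal l < ereal c" "ereal c < Limsup \<F> (\<lambda>y. ereal (w y))"
      using ereal_dense2 by (metis not_le)
    then have "\<forall>\<^sub>F y in \<F>. w y < c"
      using assms by (auto simp: is_limsup_def)
    then have "\<forall>\<^sub>F y in \<F>. ereal (w y) \<le> ereal c"
      by (auto elim!: eventually_mono)
    then have "Limsup \<F> (\<lambda>y. ereal (w y)) \<le> ereal c"
      by (rule Limsup_bounded)
    then show False using c by simp
  qed
  show "ereal l \<le> Limsup \<F> (\<lambda>y. ereal (w y))"
  proof (rule ccontr)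
    assume "\<not> ?thesis"
    then obtain c where c: "Limsup \<F> (\<lambda>y. ereal (w y)) < ereal c" "ereal c < ereal l"
      using ereal_dense2 by (metis not_le)
    have "\<forall>\<^sub>F y in \<F>. ereal (w y) < ereal c"
      using c(1) by (rule Limsup_lessD)
    then have "\<forall>\<^sub>F y in \<F>. \<not> c < w y"
      by (auto elim!: eventually_mono)
    moreover have "\<exists>\<^sub>F y in \<F>. c < w y"
      using assms c(2) by (auto simp: is_limsup_def)
    ultimately show False by (simp add: frequently_def)
  qed
qed

lemma is_limsup_uminus_imp_Liminf:
  assumes "is_limsup \<F> (\<lambda>y. - w y) (- l)"
  shows "Liminf \<F> (\<lambda>y. ereal (w y)) = ereal l"
  using is_limsup_imp_Limsup[OF assms] ereal_Limsup_uminus[of \<F> "\<lambda>y. ereal (w y)"]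
  by (cases "Liminf \<F> (\<lambda>y. ereal (w y))") auto

text \<open>This is \<open>grid_filter\<close> without the perturbation \<xi>; upper and lower
  limits along it are the half-relaxed limits.\<close>

definition grid_nhds :: "(real \<Rightarrow> 'a::metric_space set) \<Rightarrow> 'a \<Rightarrow> (real \<times> 'a) filter" where
  "grid_nhds Gr x = inf (at_right 0 \<times>\<^sub>F nhds x) (principal {(h, z). z \<in> Gr h})"

lemma eventually_at_right_0:
  "eventually P (at_right (0::real)) \<longleftrightarrow> (\<exists>d>0. \<forall>h. 0 < h \<and> h < d \<longrightarrow> P h)"
  unfolding eventually_at_right_field by (simp only: imp_conjL)

lemma eventually_grid_nhds:
  "eventually P (grid_nhds Gr x) \<longleftrightarrow>
    (\<exists>d>0. \<forall>h z. 0 < h \<and> h < d \<and> dist z x < d \<and> z \<in> Gr h \<longrightarrow> P (h, z))"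
proof
  assume "eventually P (grid_nhds Gr x)"
  then obtain Q R where "eventually Q (at_right 0)" "eventually R (nhds x)"
    and QR: "\<And>h z. Q h \<Longrightarrow> R z \<Longrightarrow> z \<in> Gr h \<Longrightarrow> P (h, z)"
    unfolding grid_nhds_def eventually_inf_principal eventually_prod_filter by auto
  then obtain d e where "d > 0" "e > 0" "\<And>h. 0 < h \<Longrightarrow> h < d \<Longrightarrow> Q h" "\<And>z. dist z x < e \<Longrightarrow> R z"
    unfolding eventually_at_right_0 eventually_nhds_metric by auto
  then show "\<exists>d>0. \<forall>h z. 0 < h \<and> h < d \<and> dist z x < d \<and> z \<in> Gr h \<longrightarrow> P (h, z)"
    using QR by (intro exI[of _ "min d e"]) auto
next
  assume "\<exists>d>0. \<forall>h z. 0 < h \<and> h < d \<and> dist z x < d \<and> z \<in> Gr h \<longrightarrow> P (h, z)"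
  then obtain d where "d > 0" and d: "\<And>h z. 0 < h \<Longrightarrow> h < d \<Longrightarrow> dist z x < d \<Longrightarrow> z \<in> Gr h \<Longrightarrow> P (h, z)"
    by blast
  have "\<forall>\<^sub>F h in at_right 0. 0 < h \<and> h < d"
    unfolding eventually_at_right_0 using \<open>d > 0\<close> by blast
  moreover have "\<forall>\<^sub>F z in nhds x. dist z x < d"
    unfolding eventually_nhds_metric using \<open>d > 0\<close> by blast
  ultimately show "eventually P (grid_nhds Gr x)"
    unfolding grid_nhds_def eventually_inf_principal eventually_prod_filter using d by blast
qed

lemma eventually_grid_filter_imp:
  assumes "eventually P (grid_filter Gr x)"
  obtains d where "d > 0" "\<And>h z \<xi>. 0 < h \<Longrightarrow> h < d \<Longrightarrow> dist z x < d \<Longrightarrow> \<bar>\<xi>\<bar> < d \<Longrightarrow> z \<in> Gr h \<Longrightarrow> P (h, z, \<xi>)"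
proof -
  obtain Q R S where "eventually Q (at_right 0)" "eventually R (nhds x)" "eventually S (nhds 0)"
    and QRS: "\<And>h z \<xi>. Q h \<Longrightarrow> R z \<Longrightarrow> S \<xi> \<Longrightarrow> z \<in> Gr h \<Longrightarrow> P (h, z, \<xi>)"
    using assms unfolding grid_filter_def eventually_inf_principal eventually_prod_filter by fastforce
  then obtain a b c where abc: "a > 0" "b > 0" "c > 0" "\<And>h. 0 < h \<Longrightarrow> h < a \<Longrightarrow> Q h"
      "\<And>z. dist z x < b \<Longrightarrow> R z" "\<And>\<xi>. dist \<xi> 0 < c \<Longrightarrow> S \<xi>"
    unfolding eventually_at_right_0 eventually_nhds_metric by auto
  show ?thesis
    by (rule that[of "min a (min b c)"]) (use abc QRS in auto)
qed

text \<open>A strict bound on the upper limit at x holds for all small h on a whole neighbourhood of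
  x, because the limit is taken jointly in h and z. A finite subcover gives one threshold for
  h.\<close>

lemma limsup_uniform_on_compact:
  fixes \<psi> :: "'a::metric_space \<Rightarrow> real"
  assumes "compact E" and "continuous_on E \<psi>"
    and lim: "\<And>x. x \<in> E \<Longrightarrow> is_limsup (grid_nhds Gr x) (\<lambda>(h, z). w h z) (W x)"
    and less: "\<And>x. x \<in> E \<Longrightarrow> W x - \<psi> x < c"
  obtains d where "d > 0" "\<And>h z. 0 < h \<Longrightarrow> h < d \<Longrightarrow> z \<in> Gr h \<Longrightarrow> z \<in> E \<Longrightarrow> w h z - \<psi> z < c"
proof -
  have "\<exists>d>0. \<forall>h z. 0 < h \<and> h < d \<and> dist z x < d \<and> z \<in> Gr h \<and> z \<in> E \<longrightarrow> w h z - \<psi> z < c"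
    if "x \<in> E" for x
  proof -
    \<comment> \<open>Half of the slack at x goes to the upper limit and half to the oscillation of
      \<psi>.\<close>
    define m where "m = (c - (W x - \<psi> x)) / 2"
    have "m > 0" using less[OF that] by (simp add: m_def)
    then have "\<forall>\<^sub>F (h, z) in grid_nhds Gr x. w h z < W x + m"
      using lim[OF that] unfolding is_limsup_def by (auto simp: case_prod_unfold)
    then obtain d where "d > 0" and d: "\<And>h z. 0 < h \<Longrightarrow> h < d \<Longrightarrow> dist z x < d \<Longrightarrow> z \<in> Gr h \<Longrightarrow> w h z < W x + m"
      unfolding eventually_grid_nhds by auto
    have "\<exists>e>0. \<forall>z\<in>E. dist z x < e \<longrightarrow> dist (\<psi> z) (\<psi> x) < m"
      using \<open>continuous_on E \<psi>\<close> that \<open>m > 0\<close> unfolding continuous_on_iff by blast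
    then obtain e where "e > 0" and e: "\<And>z. z \<in> E \<Longrightarrow> dist z x < e \<Longrightarrow> dist (\<psi> z) (\<psi> x) < m"
      by blast
    have "w h z - \<psi> z < c" if "0 < h" "h < min d e" "dist z x < min d e" "z \<in> Gr h" "z \<in> E" for h z
      using d[of h z] e[of z] that unfolding m_def dist_real_def by (simp add: field_simps) argo
    then show ?thesis
      using \<open>d > 0\<close> \<open>e > 0\<close> by (intro exI[of _ "min d e"]) auto
  qed
  then obtain D where D: "\<And>x. x \<in> E \<Longrightarrow> D x > 0"
    "\<And>x h z. x \<in> E \<Longrightarrow> 0 < h \<Longrightarrow> h < D x \<Longrightarrow> dist z x < D x \<Longrightarrow> z \<in> Gr h \<Longrightarrow> z \<in> E \<Longrightarrow> w h z - \<psi> z < c"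
    by metis
  have "E \<subseteq> (\<Union>x\<in>E. ball x (D x))"
    using D(1) by force
  then obtain T where T: "T \<subseteq> E" "finite T" "E \<subseteq> (\<Union>x\<in>T. ball x (D x))"
    using compactE_image[OF \<open>compact E\<close>, of E "\<lambda>x. ball x (D x)"] by auto
  \<comment> \<open>The inserted 1 covers the empty cover, which occurs when \<open>E\<close> is
    empty.\<close>
  define d where "d = Min (insert 1 (D ` T))"
  have "d > 0"
    using T D(1) by (auto simp: d_def)
  moreover have "w h z - \<psi> z < c" if h: "0 < h" "h < d" and z: "z \<in> Gr h" "z \<in> E" for h z
  proof -
    obtain x where x: "x \<in> T" "dist z x < D x"
      using T(3) z(2) by (auto simp: dist_commute)
    have "d \<le> D x"
      using x(1) T(2) by (simp add: d_def)
    then show ?thesis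
      using D(2)[of x h z] x h z T(1) by auto
  qed
  ultimately show ?thesis by (rule that)
qed

text \<open>The compactness step of the Barles--Souganidis argument.\<close>

lemma grid_maximum_near:
  fixes \<psi> :: "'a::metric_space \<Rightarrow> real"
  assumes "compact K" and cont: "continuous_on K \<psi>"
    and grid: "\<And>h. 0 < h \<Longrightarrow> finite (Gr h) \<and> Gr h \<subseteq> K"
    and lim: "\<And>x. x \<in> K \<Longrightarrow> is_limsup (grid_nhds Gr x) (\<lambda>(h, z). w h z) (W x)"
    and "x0 \<in> K" and "\<psi> x0 = W x0" and "0 < \<kappa>"
    and touch: "\<And>y. y \<in> K \<Longrightarrow> W y + \<kappa> * (dist y x0)\<^sup>2 \<le> \<psi> y"
    and "0 < \<delta>"
  obtains h y where "0 < h" "h < \<delta>" "y \<in> Gr h" "dist y x0 < \<delta>" "\<bar>w h y - \<psi> y\<bar> < \<delta>"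
    "\<And>z. z \<in> Gr h \<Longrightarrow> w h z - \<psi> z \<le> w h y - \<psi> y"
proof -
  \<comment> \<open>Outside the ball the gap is at least \<kappa> \<delta>^2; half of it leaves a
    strict inequality.\<close>
  define \<eta> where "\<eta> = \<kappa> * \<delta>\<^sup>2 / 2"
  define m where "m = min \<eta> \<delta>"
  have "\<eta> > 0" "m > 0"
    using \<open>0 < \<kappa>\<close> \<open>0 < \<delta>\<close> by (simp_all add: \<eta>_def m_def)
  have far: "W x - \<psi> x < - \<eta>" if "x \<in> K - ball x0 \<delta>" for x
  proof -
    have "\<delta>\<^sup>2 \<le> (dist x x0)\<^sup>2"
      using that \<open>0 < \<delta>\<close> by (intro power_mono) (auto simp: dist_commute)
    then have "2 * \<eta> \<le> \<kappa> * (dist x x0)\<^sup>2"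
      using \<open>0 < \<kappa>\<close> by (simp add: \<eta>_def)
    then show ?thesis
      using touch[of x] that \<open>\<eta> > 0\<close> by auto
  qed
  have "compact (K - ball x0 \<delta>)"
    using \<open>compact K\<close> by (rule compact_diff) simp
  moreover have "continuous_on (K - ball x0 \<delta>) \<psi>"
    using cont by (rule continuous_on_subset) auto
  ultimately obtain d1 where "d1 > 0" and
    d1: "\<And>h z. 0 < h \<Longrightarrow> h < d1 \<Longrightarrow> z \<in> Gr h \<Longrightarrow> z \<in> K - ball x0 \<delta> \<Longrightarrow> w h z - \<psi> z < - \<eta>"
    using limsup_uniform_on_compact[of "K - ball x0 \<delta>" \<psi> Gr w W "- \<eta>"] lim far by (metis DiffD1)
  have "W x - \<psi> x < \<delta>" if "x \<in> K" for x
    using touch[OF that] \<open>0 < \<delta>\<close> \<open>0 < \<kappa>\<close> by (smt (verit) mult_nonneg_nonneg zero_le_power2)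
  then obtain d2 where "d2 > 0" and
    d2: "\<And>h z. 0 < h \<Longrightarrow> h < d2 \<Longrightarrow> z \<in> Gr h \<Longrightarrow> z \<in> K \<Longrightarrow> w h z - \<psi> z < \<delta>"
    using limsup_uniform_on_compact[OF \<open>compact K\<close> cont lim] by metis
  have "m / 2 > 0" using \<open>m > 0\<close> by simp
  then have "\<exists>e>0. \<forall>z\<in>K. dist z x0 < e \<longrightarrow> dist (\<psi> z) (\<psi> x0) < m / 2"
    using cont \<open>x0 \<in> K\<close> unfolding continuous_on_iff by blast
  then obtain d3 where "d3 > 0" and d3: "\<And>z. z \<in> K \<Longrightarrow> dist z x0 < d3 \<Longrightarrow> dist (\<psi> z) (\<psi> x0) < m / 2"
    by blast
  define d where "d = min \<delta> (min d1 (min d2 d3))"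
  have "d > 0"
    using \<open>0 < \<delta>\<close> \<open>d1 > 0\<close> \<open>d2 > 0\<close> \<open>d3 > 0\<close> by (simp add: d_def)
  \<comment> \<open>Some grid point near \<open>x0\<close> has difference above -m, hence so has the
    maximum over the finite grid. Differences outside the ball are below -\<eta> \<le> -m, so the
    maximiser lies inside.\<close>
  have "\<exists>\<^sub>F (h, z) in grid_nhds Gr x0. W x0 - m / 2 < w h z"
    using lim[OF \<open>x0 \<in> K\<close>] \<open>m > 0\<close> unfolding is_limsup_def by (auto simp: case_prod_unfold)
  then obtain h z where h: "0 < h" "h < d" and z: "dist z x0 < d" "z \<in> Gr h" and big: "W x0 - m / 2 < w h z"
    using \<open>d > 0\<close> unfolding frequently_def eventually_grid_nhds by auto
  have "z \<in> K" using grid h z by blast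
  have zval: "w h z - \<psi> z > - m"
    using d3[OF \<open>z \<in> K\<close>] z(1) big \<open>\<psi> x0 = W x0\<close> by (simp add: d_def dist_real_def) argo
  have "finite (Gr h)" "Gr h \<noteq> {}"
    using grid h z by auto
  then have "Max ((\<lambda>z. w h z - \<psi> z) ` Gr h) \<in> (\<lambda>z. w h z - \<psi> z) ` Gr h"
    by (intro Max_in) auto
  then obtain y where "y \<in> Gr h" and ymax: "w h y - \<psi> y = Max ((\<lambda>z. w h z - \<psi> z) ` Gr h)"
    by auto
  have y: "y \<in> Gr h" "\<And>z. z \<in> Gr h \<Longrightarrow> w h z - \<psi> z \<le> w h y - \<psi> y"
    unfolding ymax using \<open>finite (Gr h)\<close> \<open>y \<in> Gr h\<close> by simp_all
  have yval: "w h y - \<psi> y > - m"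
    using y(2)[OF z(2)] zval by simp
  have "y \<in> K" using grid h y by blast
  have hd: "h < \<delta>" "h < d1" "h < d2"
    using h by (simp_all add: d_def)
  have md: "m \<le> \<eta>" "m \<le> \<delta>"
    by (simp_all add: m_def)
  have near: "dist y x0 < \<delta>"
  proof (rule ccontr)
    assume "\<not> dist y x0 < \<delta>"
    then have "w h y - \<psi> y < - \<eta>"
      using \<open>y \<in> K\<close> by (intro d1 h(1) hd y(1)) (simp add: dist_commute)
    then show False
      using yval md by linarith
  qed
  have "w h y - \<psi> y < \<delta>"
    using \<open>y \<in> K\<close> by (intro d2 h(1) hd y(1))
  then have "\<bar>w h y - \<psi> y\<bar> < \<delta>"
    using yval md by linarith
  then show ?thesis
    using that h(1) hd(1) y near by blast
qed

section \<open>Half-relaxed limits of scheme solutions\<close>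

lemma modified_det_add_mat_tendsto:
  assumes "modified_det detp" and "H \<in> sym_matrices"
  shows "((\<lambda>c. detp (H + mat c)) \<longlongrightarrow> detp H) (at_right 0)"
    and "((\<lambda>c. detp (H + mat (- c))) \<longlongrightarrow> detp H) (at_right 0)"
proof -
  have mat: "(mat c :: real^'n^'n) = c *\<^sub>R mat 1" for c
    by (simp add: vec_eq_iff mat_def)
  have lim: "((\<lambda>c. detp (H + mat (s * c))) \<longlongrightarrow> detp H) (at_right 0)" for s
  proof (rule continuous_on_tendsto_compose[where f = detp and s = sym_matrices])
    show "continuous_on sym_matrices detp"
      using assms by (simp add: modified_det_def)
    have "((\<lambda>c. H + (s * c) *\<^sub>R mat 1) \<longlongrightarrow> H + (s * 0) *\<^sub>R mat 1) (at_right 0)"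
      by (intro tendsto_intros)
    then show "((\<lambda>c. H + mat (s * c)) \<longlongrightarrow> H) (at_right 0)"
      by (subst mat) simp
    show "\<forall>\<^sub>F c in at_right 0. H + mat (s * c) \<in> sym_matrices"
      by (intro always_eventually allI sym_matrices_add mat_in_sym_matrices assms(2))
  qed (rule assms(2))
  show "((\<lambda>c. detp (H + mat c)) \<longlongrightarrow> detp H) (at_right 0)"
    and "((\<lambda>c. detp (H + mat (- c))) \<longlongrightarrow> detp H) (at_right 0)"
    using lim[of 1] lim[of "-1"] by simp_all
qed

text \<open>If s \<le> g x at a boundary point, the minimum is nonpositive whatever the Hessian.
  Otherwise the Monge-Ampere branch is nonpositive for every shift, and this survives the
  limit.\<close>

lemma MA_lower_nonpos_closed:
  assumes "modified_det detp" and "H \<in> sym_matrices"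
    and "\<And>c. 0 < c \<Longrightarrow> MA_lower \<Omega> detp f g x s p (H + mat c) \<le> 0"
  shows "MA_lower \<Omega> detp f g x s p H \<le> 0"
proof (cases "x \<notin> \<Omega> \<and> s \<le> g x")
  case True
  then show ?thesis by (simp add: MA_lower_def min_def)
next
  case False
  then have "f x s p \<le> detp (H + mat c)" if "0 < c" for c
    using assms(3)[OF that] by (auto simp: MA_lower_def min_def split: if_splits)
  then have "\<forall>\<^sub>F c in at_right 0. f x s p \<le> detp (H + mat c)"
    by (auto simp: eventually_at_right_0 intro: exI[of _ 1])
  then have "f x s p \<le> detp H"
    using modified_det_add_mat_tendsto(1)[OF assms(1,2)]
    by (intro tendsto_lowerbound[where F = "at_right (0::real)"]) auto
  then show ?thesis by (auto simp: MA_lower_def)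
qed

lemma MA_upper_nonneg_closed:
  assumes "modified_det detp" and "H \<in> sym_matrices"
    and "\<And>c. 0 < c \<Longrightarrow> 0 \<le> MA_upper \<Omega> detp f g x s p (H + mat (- c))"
  shows "0 \<le> MA_upper \<Omega> detp f g x s p H"
proof (cases "x \<notin> \<Omega> \<and> g x \<le> s")
  case True
  then show ?thesis by (simp add: MA_upper_def max_def)
next
  case False
  then have "detp (H + mat (- c)) \<le> f x s p" if "0 < c" for c
    using assms(3)[OF that] by (auto simp: MA_upper_def max_def split: if_splits)
  then have "\<forall>\<^sub>F c in at_right 0. detp (H + mat (- c)) \<le> f x s p"
    by (auto simp: eventually_at_right_0 intro: exI[of _ 1])
  then have "detp H \<le> f x s p"
    using modified_det_add_mat_tendsto(2)[OF assms(1,2)]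
    by (intro tendsto_upperbound[where F = "at_right (0::real)"]) auto
  then show ?thesis by (auto simp: MA_upper_def)
qed

text \<open>At a grid maximum of \<open>uh - \<psi>\<close> the differences of \<psi> are at most
  those of the scheme solution, so monotonicity makes the scheme nonpositive on \<psi>. A positive
  lower operator would contradict this by consistency.\<close>

lemma scheme_limsup_subsolution_at:
  fixes \<Omega> :: "(real^'n) set"
  assumes "open \<Omega>" "convex \<Omega>" "bounded \<Omega>" and md: "modified_det detp"
    and grid: "\<And>h. 0 < h \<Longrightarrow> finite (Gr h) \<and> Gr h \<subseteq> closure \<Omega>"
    and cons: "scheme_consistent \<Omega> detp f g Gr F"
    and mono: "scheme_monotone Gr F"
    and sol: "\<And>h. h > 0 \<Longrightarrow> scheme_solution Gr F h (uh h)"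
    and lim: "\<And>x. x \<in> closure \<Omega> \<Longrightarrow> is_limsup (grid_nhds Gr x) (\<lambda>(h, z). uh h z) (W x)"
    and bound: "\<And>x. x \<in> closure \<Omega> \<Longrightarrow> W x \<le> M"
    and C2: "C2_closure \<Omega> \<phi> G H" and x0: "x0 \<in> closure \<Omega>"
    and max: "\<forall>\<^sub>F y in at x0 within closure \<Omega>. W y - \<phi> y \<le> W x0 - \<phi> x0"
  shows "MA_lower \<Omega> detp f g x0 (W x0) (G x0) (H x0) \<le> 0"
proof (rule MA_lower_nonpos_closed[OF md])
  show sym: "H x0 \<in> sym_matrices"
    using C2_closure_hessian_sym[OF \<open>open \<Omega>\<close> C2 x0] .
  fix c :: real assume "0 < c"
  let ?A = "H x0 + mat c"
  have symA: "?A \<in> sym_matrices"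
    using sym mat_in_sym_matrices by (rule sym_matrices_add)
  \<comment> \<open>Taking \<epsilon> = c/2 makes the Hessian shift exactly \<open>mat c\<close> and
    leaves the gap c/4.\<close>
  obtain C where C: "\<And>y. y \<in> closure \<Omega> \<Longrightarrow>
      W y + c / 4 * (dist y x0)\<^sup>2 \<le> quartic x0 (W x0) (G x0) ?A C y"
    using quartic_touches_from_above[OF assms(1-3) C2 x0 _ max bound, of "c / 2"] \<open>0 < c\<close> by auto
  define \<psi> where "\<psi> = quartic x0 (W x0) (G x0) ?A C"
  have C2\<psi>: "C2_closure \<Omega> \<psi> (quartic_grad x0 (G x0) ?A C) (quartic_hess x0 ?A C)"
    unfolding \<psi>_def by (rule C2_closure_quartic[OF symA])
  have "\<psi> x0 = W x0"
    by (simp add: \<psi>_def)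
  show "MA_lower \<Omega> detp f g x0 (W x0) (G x0) ?A \<le> 0"
  proof (rule ccontr)
    assume pos: "\<not> ?thesis"
    have "ereal (MA_lower \<Omega> detp f g x0 (\<psi> x0) (quartic_grad x0 (G x0) ?A C x0) (quartic_hess x0 ?A C x0))
        \<le> Liminf (grid_filter Gr x0) (\<lambda>(h, z, \<xi>). ereal (F h z (\<psi> z + \<xi>) (\<lambda>y. \<psi> z - \<psi> y)))"
      using cons C2\<psi> x0 smooth_closure_quartic[of \<Omega>] unfolding scheme_consistent_def \<psi>_def by blast
    moreover have "0 < ereal (MA_lower \<Omega> detp f g x0 (\<psi> x0) (quartic_grad x0 (G x0) ?A C x0) (quartic_hess x0 ?A C x0))"
      using pos by (simp add: \<open>\<psi> x0 = W x0\<close>)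
    ultimately have "0 < Liminf (grid_filter Gr x0) (\<lambda>(h, z, \<xi>). ereal (F h z (\<psi> z + \<xi>) (\<lambda>y. \<psi> z - \<psi> y)))"
      by (rule less_le_trans[rotated])
    then have "\<forall>\<^sub>F (h, z, \<xi>) in grid_filter Gr x0. 0 < F h z (\<psi> z + \<xi>) (\<lambda>y. \<psi> z - \<psi> y)"
      by (auto dest!: less_LiminfD elim!: eventually_mono)
    then obtain d where "d > 0" and d: "\<And>h z \<xi>. 0 < h \<Longrightarrow> h < d \<Longrightarrow> dist z x0 < d \<Longrightarrow> \<bar>\<xi>\<bar> < d \<Longrightarrow>
        z \<in> Gr h \<Longrightarrow> 0 < F h z (\<psi> z + \<xi>) (\<lambda>y. \<psi> z - \<psi> y)"
      by (rule eventually_grid_filter_imp) blast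
    have "compact (closure \<Omega>)" using \<open>bounded \<Omega>\<close> by (simp add: compact_closure)
    moreover have "continuous_on (closure \<Omega>) \<psi>" using C2\<psi> by (simp add: C2_closure_def)
    moreover have "W y + c / 4 * (dist y x0)\<^sup>2 \<le> \<psi> y" if "y \<in> closure \<Omega>" for y
      using C[OF that] by (simp add: \<psi>_def)
    moreover have "c / 4 > 0" using \<open>0 < c\<close> by simp
    ultimately obtain h y where hy: "0 < h" "h < d" "y \<in> Gr h" "dist y x0 < d" "\<bar>uh h y - \<psi> y\<bar> < d"
      and ymax: "\<And>z. z \<in> Gr h \<Longrightarrow> uh h z - \<psi> z \<le> uh h y - \<psi> y"
      using grid_maximum_near[of "closure \<Omega>" \<psi> Gr uh W x0 "c / 4" d] grid lim x0 \<open>\<psi> x0 = W x0\<close> \<open>d > 0\<close> by metis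
    have "F h y (uh h y) (\<lambda>z. \<psi> y - \<psi> z) \<le> F h y (uh h y) (\<lambda>z. uh h y - uh h z)"
    proof -
      have "\<forall>z\<in>Gr h. \<psi> y - \<psi> z \<le> uh h y - uh h z"
        using ymax by (auto simp: algebra_simps)
      then show ?thesis
        using mono hy(1,3) unfolding scheme_monotone_def by (metis order_refl)
    qed
    also have "\<dots> = 0"
      using sol[OF hy(1)] hy(3) by (simp add: scheme_solution_def)
    \<comment> \<open>The perturbation is \<xi> = \<open>uh h y - \<psi> y\<close>, which turns
      \<psi> y + \<xi> into the value of the scheme solution.\<close>
    finally show False
      using d[OF hy(1,2,4,5,3)] by simp
  qed
qed

text \<open>The operator is not odd, so the equation itself cannot be negated. Only the choice of
  the quartic and of the grid point is made for \<open>- W\<close>; consistency and monotonicity are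
  then applied to the negated quartic.\<close>

lemma scheme_liminf_supersolution_at:
  fixes \<Omega> :: "(real^'n) set"
  assumes "open \<Omega>" "convex \<Omega>" "bounded \<Omega>" and md: "modified_det detp"
    and grid: "\<And>h. 0 < h \<Longrightarrow> finite (Gr h) \<and> Gr h \<subseteq> closure \<Omega>"
    and cons: "scheme_consistent \<Omega> detp f g Gr F"
    and mono: "scheme_monotone Gr F"
    and sol: "\<And>h. h > 0 \<Longrightarrow> scheme_solution Gr F h (uh h)"
    and lim: "\<And>x. x \<in> closure \<Omega> \<Longrightarrow> is_limsup (grid_nhds Gr x) (\<lambda>(h, z). - uh h z) (- W x)"
    and bound: "\<And>x. x \<in> closure \<Omega> \<Longrightarrow> - M \<le> W x"
    and C2: "C2_closure \<Omega> \<phi> G H" and x0: "x0 \<in> closure \<Omega>"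
    and min: "\<forall>\<^sub>F y in at x0 within closure \<Omega>. W y - \<phi> y \<ge> W x0 - \<phi> x0"
  shows "0 \<le> MA_upper \<Omega> detp f g x0 (W x0) (G x0) (H x0)"
proof (rule MA_upper_nonneg_closed[OF md])
  show sym: "H x0 \<in> sym_matrices"
    using C2_closure_hessian_sym[OF \<open>open \<Omega>\<close> C2 x0] .
  fix c :: real assume "0 < c"
  let ?A = "- H x0 + mat c"
  have symA: "?A \<in> sym_matrices"
    using sym mat_in_sym_matrices by (intro sym_matrices_add sym_matrices_minus)
  have minusA: "- ?A = H x0 + mat (- c)"
    by (simp add: vec_eq_iff mat_def)
  have max: "\<forall>\<^sub>F y in at x0 within closure \<Omega>. - W y - (- \<phi> y) \<le> - W x0 - (- \<phi> x0)"
    using min by (auto elim!: eventually_mono)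
  have bound': "- W x \<le> M" if "x \<in> closure \<Omega>" for x
    using bound[OF that] by simp
  obtain C where C: "\<And>y. y \<in> closure \<Omega> \<Longrightarrow>
      - W y + c / 4 * (dist y x0)\<^sup>2 \<le> quartic x0 (- W x0) (- G x0) ?A C y"
    using quartic_touches_from_above[OF assms(1-3) C2_closure_uminus[OF C2] x0 _ max bound', of "c / 2"] \<open>0 < c\<close> by auto
  define \<theta> where "\<theta> = quartic x0 (- W x0) (- G x0) ?A C"
  define \<psi> where "\<psi> y = - \<theta> y" for y
  have C2\<theta>: "C2_closure \<Omega> \<theta> (quartic_grad x0 (- G x0) ?A C) (quartic_hess x0 ?A C)"
    unfolding \<theta>_def by (rule C2_closure_quartic[OF symA])
  have C2\<psi>: "C2_closure \<Omega> \<psi> (\<lambda>x. - quartic_grad x0 (- G x0) ?A C x) (\<lambda>x. - quartic_hess x0 ?A C x)"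
    unfolding \<psi>_def by (rule C2_closure_uminus[OF C2\<theta>])
  have smooth: "smooth_closure \<Omega> \<psi>"
    unfolding \<psi>_def \<theta>_def by (intro smooth_closure_uminus smooth_closure_quartic)
  have "\<theta> x0 = - W x0" "\<psi> x0 = W x0"
    by (simp_all add: \<psi>_def \<theta>_def)
  show "0 \<le> MA_upper \<Omega> detp f g x0 (W x0) (G x0) (H x0 + mat (- c))"
  proof (rule ccontr)
    assume neg: "\<not> ?thesis"
    have "Limsup (grid_filter Gr x0) (\<lambda>(h, z, \<xi>). ereal (F h z (\<psi> z + \<xi>) (\<lambda>y. \<psi> z - \<psi> y)))
        \<le> ereal (MA_upper \<Omega> detp f g x0 (\<psi> x0) (- quartic_grad x0 (- G x0) ?A C x0) (- quartic_hess x0 ?A C x0))"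
      using cons C2\<psi> x0 smooth unfolding scheme_consistent_def by blast
    also have "\<dots> < 0"
      using neg unfolding \<open>\<psi> x0 = W x0\<close> quartic_center minusA minus_minus by simp
    finally have "\<forall>\<^sub>F (h, z, \<xi>) in grid_filter Gr x0. F h z (\<psi> z + \<xi>) (\<lambda>y. \<psi> z - \<psi> y) < 0"
      by (auto dest!: Limsup_lessD elim!: eventually_mono)
    then obtain d where "d > 0" and d: "\<And>h z \<xi>. 0 < h \<Longrightarrow> h < d \<Longrightarrow> dist z x0 < d \<Longrightarrow> \<bar>\<xi>\<bar> < d \<Longrightarrow>
        z \<in> Gr h \<Longrightarrow> F h z (\<psi> z + \<xi>) (\<lambda>y. \<psi> z - \<psi> y) < 0"
      by (rule eventually_grid_filter_imp) blast
    have "compact (closure \<Omega>)" using \<open>bounded \<Omega>\<close> by (simp add: compact_closure)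
    moreover have "continuous_on (closure \<Omega>) \<theta>" using C2\<theta> by (simp add: C2_closure_def)
    moreover have "- W y + c / 4 * (dist y x0)\<^sup>2 \<le> \<theta> y" if "y \<in> closure \<Omega>" for y
      using C[OF that] by (simp add: \<theta>_def)
    moreover have "c / 4 > 0" using \<open>0 < c\<close> by simp
    ultimately obtain h y where hy: "0 < h" "h < d" "y \<in> Gr h" "dist y x0 < d" "\<bar>- uh h y - \<theta> y\<bar> < d"
      and ymax: "\<And>z. z \<in> Gr h \<Longrightarrow> - uh h z - \<theta> z \<le> - uh h y - \<theta> y"
      using grid_maximum_near[of "closure \<Omega>" \<theta> Gr "\<lambda>h z. - uh h z" "\<lambda>x. - W x" x0 "c / 4" d]
        grid lim x0 \<open>\<theta> x0 = - W x0\<close> \<open>d > 0\<close> by metis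
    have xi: "\<bar>uh h y - \<psi> y\<bar> < d"
      using hy(5) by (simp add: \<psi>_def)
    have "0 = F h y (uh h y) (\<lambda>z. uh h y - uh h z)"
      using sol[OF hy(1)] hy(3) by (simp add: scheme_solution_def)
    also have "\<dots> \<le> F h y (uh h y) (\<lambda>z. \<psi> y - \<psi> z)"
    proof -
      have "\<forall>z\<in>Gr h. uh h y - uh h z \<le> \<psi> y - \<psi> z"
        using ymax by (auto simp: \<psi>_def algebra_simps)
      then show ?thesis
        using mono hy(1,3) unfolding scheme_monotone_def by (metis order_refl)
    qed
    finally show False
      using d[OF hy(1,2,4) xi hy(3)] by simp
  qed
qed

section \<open>Semicontinuous functions\<close>

lemma usc_on_metric:
  fixes W :: "'a::metric_space \<Rightarrow> real"
  shows "usc_on K W \<longleftrightarrow> (\<forall>x\<in>K. \<forall>c>W x. \<exists>r>0. \<forall>y\<in>K. dist y x < r \<longrightarrow> W y < c)"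
  unfolding usc_on_def eventually_at by (intro ball_cong all_cong ex_cong refl) (metis zero_less_dist_iff)

lemma lsc_on_iff_usc_on_uminus: "lsc_on K W \<longleftrightarrow> usc_on K (\<lambda>x. - W x)"
proof -
  have "(\<forall>c<W x. P c) \<longleftrightarrow> (\<forall>c>- W x. P (- c))" for x P
    by (metis minus_minus neg_less_iff_less)
  then show ?thesis
    unfolding usc_on_def lsc_on_def by (simp add: minus_less_iff[of "W _"])
qed

lemma usc_on_diff_continuous:
  fixes W :: "'a::metric_space \<Rightarrow> real"
  assumes "usc_on K W" "continuous_on K \<phi>"
  shows "usc_on K (\<lambda>x. W x - \<phi> x)"
  unfolding usc_on_metric
proof (intro ballI allI impI)
  fix x c assume x: "x \<in> K" and c: "W x - \<phi> x < c"
  define e where "e = (c - (W x - \<phi> x)) / 2"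
  have "e > 0" using c by (simp add: e_def)
  then have "W x < W x + e" by simp
  then obtain r where "r > 0" and r: "\<And>y. y \<in> K \<Longrightarrow> dist y x < r \<Longrightarrow> W y < W x + e"
    using assms(1) x unfolding usc_on_metric by blast
  obtain s where "s > 0" and s: "\<And>y. y \<in> K \<Longrightarrow> dist y x < s \<Longrightarrow> dist (\<phi> y) (\<phi> x) < e"
    using assms(2) x \<open>e > 0\<close> unfolding continuous_on_iff by blast
  have "W y - \<phi> y < c" if "y \<in> K" "dist y x < min r s" for y
  proof -
    have "W y < W x + e" "\<phi> x - e < \<phi> y"
      using r[of y] s[of y] that by (auto simp: dist_real_def)
    moreover have "c = W x - \<phi> x + 2 * e" by (simp add: e_def field_simps)
    ultimately show ?thesis by linarith
  qed
  then show "\<exists>r>0. \<forall>y\<in>K. dist y x < r \<longrightarrow> W y - \<phi> y < c"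
    using \<open>r > 0\<close> \<open>s > 0\<close> by (intro exI[of _ "min r s"]) auto
qed

text \<open>Without a maximum, each x has a neighbourhood on which \<open>W\<close> stays below the
  value at some \<open>Y x\<close>. Among finitely many such neighbourhoods covering
  \<open>K\<close>, the point \<open>Y t\<close> of largest value lies in one of them, which is
  absurd.\<close>

lemma usc_on_attains_sup:
  fixes W :: "'a::metric_space \<Rightarrow> real"
  assumes "compact K" "K \<noteq> {}" "usc_on K W"
  obtains x where "x \<in> K" "\<And>y. y \<in> K \<Longrightarrow> W y \<le> W x"
proof (rule ccontr)
  assume "\<not> thesis"
  then have "\<exists>y\<in>K. W x < W y" if "x \<in> K" for x
    using that \<open>\<And>x. x \<in> K \<Longrightarrow> (\<And>y. y \<in> K \<Longrightarrow> W y \<le> W x) \<Longrightarrow> thesis\<close> by (meson not_le)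
  then obtain Y where Y: "\<And>x. x \<in> K \<Longrightarrow> Y x \<in> K \<and> W x < W (Y x)"
    by metis
  then have "\<forall>x\<in>K. \<exists>r>0. \<forall>y\<in>K. dist y x < r \<longrightarrow> W y < W (Y x)"
    using assms(3) unfolding usc_on_metric by blast
  then obtain R where R: "\<And>x. x \<in> K \<Longrightarrow> R x > 0"
    "\<And>x y. x \<in> K \<Longrightarrow> y \<in> K \<Longrightarrow> dist y x < R x \<Longrightarrow> W y < W (Y x)"
    by metis
  have "K \<subseteq> (\<Union>x\<in>K. ball x (R x))"
    using R(1) by force
  then obtain T where T: "T \<subseteq> K" "finite T" "K \<subseteq> (\<Union>x\<in>T. ball x (R x))"
    using compactE_image[OF \<open>compact K\<close>, of K "\<lambda>x. ball x (R x)"] by auto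
  have "T \<noteq> {}" using T(3) \<open>K \<noteq> {}\<close> by auto
  then have "Max ((\<lambda>x. W (Y x)) ` T) \<in> (\<lambda>x. W (Y x)) ` T"
    using T(2) by (intro Max_in) auto
  then obtain t where t: "t \<in> T" "W (Y t) = Max ((\<lambda>x. W (Y x)) ` T)"
    by auto
  obtain s where s: "s \<in> T" "dist (Y t) s < R s"
    using T(1,3) Y t(1) by (fastforce simp: dist_commute)
  have "W (Y t) < W (Y s)"
    using R(2)[of s "Y t"] s T(1) Y t(1) by auto
  also have "\<dots> \<le> W (Y t)"
    unfolding t(2) using T(2) s(1) by simp
  finally show False by simp
qed

text \<open>A bound on the grid values near x is also a bound near every y close to x, with the
  radius reduced by the distance from y to x.\<close>

lemma grid_limsup_usc_on:
  fixes W :: "'a::metric_space \<Rightarrow> real"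
  assumes lim: "\<And>x. x \<in> K \<Longrightarrow> is_limsup (grid_nhds Gr x) w (W x)"
  shows "usc_on K W"
  unfolding usc_on_metric
proof (intro ballI allI impI)
  fix x c assume x: "x \<in> K" and c: "W x < c"
  obtain b where b: "W x < b" "b < c"
    using dense[OF c] by blast
  then have "eventually (\<lambda>y. w y < b) (grid_nhds Gr x)"
    using lim[OF x] by (simp add: is_limsup_def)
  then obtain d where "d > 0" and d: "\<And>h z. 0 < h \<Longrightarrow> h < d \<Longrightarrow> dist z x < d \<Longrightarrow> z \<in> Gr h \<Longrightarrow> w (h, z) < b"
    unfolding eventually_grid_nhds by blast
  have "W y < c" if y: "y \<in> K" "dist y x < d" for y
  proof (rule ccontr)
    assume "\<not> W y < c"
    then have "b < W y" using b by simp
    then have "\<exists>\<^sub>F q in grid_nhds Gr y. b < w q"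
      using lim[OF y(1)] by (simp add: is_limsup_def)
    moreover have "w (h, z) < b" if "0 < h" "h < d - dist y x" "dist z y < d - dist y x" "z \<in> Gr h" for h z
      using that dist_triangle[of z x y] zero_le_dist[of y x] by (intro d) (linarith | assumption)+
    then have "\<forall>\<^sub>F q in grid_nhds Gr y. \<not> b < w q"
      unfolding eventually_grid_nhds using y(2)
      by (intro exI[of _ "d - dist y x"]) (auto simp: not_less intro!: less_imp_le)
    ultimately show False
      by (simp add: frequently_def)
  qed
  then show "\<exists>r>0. \<forall>y\<in>K. dist y x < r \<longrightarrow> W y < c"
    using \<open>d > 0\<close> by blast
qed

section \<open>Behaviour at the boundary\<close>

text \<open>Near a boundary point \<open>x0\<close> with outward normal \<open>\<nu>\<close>, uniform convexity makes the concave function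
  \<open>- M * (\<nu> \<bullet> (x - x0)) - \<bar>x - x0\<bar>\<^sup>2\<close> grow quadratically on the closure of the domain. Its negative
  definite Hessian rules out every other way of being a subsolution.\<close>

lemma subsolution_le_boundary_data:
  fixes \<Omega> :: "(real^'n) set"
  assumes "open \<Omega>" and uc: "uniformly_convex \<Omega>" and md: "modified_det detp"
    and f_nonneg: "\<And>x s p. x \<in> closure \<Omega> \<Longrightarrow> 0 \<le> f x s p"
    and lip: "L-lipschitz_on (closure \<Omega>) u" and ug: "\<And>x. x \<in> frontier \<Omega> \<Longrightarrow> u x = g x"
    and sub: "viscosity_subsolution \<Omega> detp f g W"
    and x0: "x0 \<in> frontier \<Omega>"
  shows "W x0 \<le> g x0"
proof (rule ccontr)
  assume "\<not> W x0 \<le> g x0"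
  define e where "e = W x0 - g x0"
  have "e > 0" using \<open>\<not> W x0 \<le> g x0\<close> by (simp add: e_def)
  have fr: "frontier \<Omega> = closure \<Omega> - \<Omega>"
    using \<open>open \<Omega>\<close> by (simp add: frontier_def interior_open)
  have x0c: "x0 \<in> closure \<Omega>" and "x0 \<notin> \<Omega>" using x0 by (auto simp: fr)
  have "convex \<Omega>" "bounded \<Omega>" using uc by (auto simp: uniformly_convex_def)
  obtain \<alpha> where "\<alpha> > 0" and \<alpha>: "\<And>\<nu> x. norm \<nu> = 1 \<Longrightarrow> (\<forall>x\<in>closure \<Omega>. (x - x0) \<bullet> \<nu> \<le> 0) \<Longrightarrow>
      x \<in> closure \<Omega> \<Longrightarrow> (x - x0) \<bullet> \<nu> \<le> - \<alpha> * (norm (x - x0))\<^sup>2"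
    using uc x0 unfolding uniformly_convex_def by blast
  have "x0 \<notin> rel_interior \<Omega>"
    using \<open>x0 \<notin> \<Omega>\<close> rel_interior_subset by blast
  then obtain a where "a \<noteq> 0" and a: "\<And>y. y \<in> closure \<Omega> \<Longrightarrow> a \<bullet> x0 \<le> a \<bullet> y"
    using supporting_hyperplane_relative_frontier[OF \<open>convex \<Omega>\<close> x0c] by metis
  \<comment> \<open>The supporting functional \<open>a\<close> points into the domain, hence the
    sign.\<close>
  define \<nu> where "\<nu> = - (a /\<^sub>R norm a)"
  have "norm \<nu> = 1" using \<open>a \<noteq> 0\<close> by (simp add: \<nu>_def)
  moreover have "\<forall>x\<in>closure \<Omega>. (x - x0) \<bullet> \<nu> \<le> 0"
    using a \<open>a \<noteq> 0\<close> by (auto simp: \<nu>_def inner_commute[of _ a] inner_diff_right divide_simps)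
  ultimately have \<nu>: "(x - x0) \<bullet> \<nu> \<le> - \<alpha> * (norm (x - x0))\<^sup>2" if "x \<in> closure \<Omega>" for x
    using \<alpha> that by blast
  \<comment> \<open>Chosen so that L t - k t^2, whose maximum over t is L^2/(4 k), stays below
    e.\<close>
  define k where "k = (L\<^sup>2 + 1) / e"
  have "k > 0" using \<open>e > 0\<close> by (simp add: k_def add_nonneg_pos)
  \<comment> \<open>Uniform convexity turns the linear term into growth (k + 1) |x - x0|^2; the
    extra 1 pays for the concave part -|x - x0|^2.\<close>
  define M where "M = (k + 1) / \<alpha>"
  have "M > 0" using \<open>k > 0\<close> \<open>\<alpha> > 0\<close> by (simp add: M_def)
  let ?A = "mat (-2) :: real^'n^'n"
  define \<phi> where "\<phi> = quartic x0 0 (- M *\<^sub>R \<nu>) ?A 0"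
  have C2: "C2_closure \<Omega> \<phi> (quartic_grad x0 (- M *\<^sub>R \<nu>) ?A 0) (quartic_hess x0 ?A 0)"
    unfolding \<phi>_def by (rule C2_closure_quartic[OF mat_in_sym_matrices])
  have "\<phi> x0 = 0" by (simp add: \<phi>_def)
  have growth: "k * (norm (y - x0))\<^sup>2 \<le> \<phi> y" if "y \<in> closure \<Omega>" for y
  proof -
    have "M * ((y - x0) \<bullet> \<nu>) \<le> M * (- \<alpha> * (norm (y - x0))\<^sup>2)"
      using \<open>M > 0\<close> by (intro mult_left_mono[OF \<nu>[OF that]]) simp
    also have "\<dots> = - (M * \<alpha>) * (norm (y - x0))\<^sup>2"
      by simp
    also have "M * \<alpha> = k + 1"
      using \<open>\<alpha> > 0\<close> by (simp add: M_def)
    finally show ?thesis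
      by (simp add: \<phi>_def quartic_def mat_mult_vector inner_commute[of \<nu>] power2_norm_eq_inner algebra_simps)
  qed
  have "compact (closure \<Omega>)" "closure \<Omega> \<noteq> {}"
    using \<open>bounded \<Omega>\<close> x0c by (auto simp: compact_closure)
  moreover have "usc_on (closure \<Omega>) (\<lambda>x. W x - \<phi> x)"
    using sub C2 by (intro usc_on_diff_continuous) (auto simp: viscosity_subsolution_def C2_closure_def)
  ultimately obtain y where y: "y \<in> closure \<Omega>" and ymax: "\<And>z. z \<in> closure \<Omega> \<Longrightarrow> W z - \<phi> z \<le> W y - \<phi> y"
    by (rule usc_on_attains_sup) blast
  have "\<forall>\<^sub>F z in at y within closure \<Omega>. W z - \<phi> z \<le> W y - \<phi> y"
    using ymax by (auto simp: eventually_at intro: exI[of _ 1])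
  then have "MA_lower \<Omega> detp f g y (W y) (quartic_grad x0 (- M *\<^sub>R \<nu>) ?A 0 y) (quartic_hess x0 ?A 0 y) \<le> 0"
    using sub C2 y unfolding viscosity_subsolution_def by blast
  \<comment> \<open>The Monge-Ampere branch is positive everywhere, so the subsolution inequality
    can hold only through the boundary condition at \<open>y\<close>.\<close>
  moreover have "- detp (quartic_hess x0 ?A 0 y) + f y s p > 0" for s p
    using f_nonneg[OF y, of s p] modified_det_mat_neg[OF md, of "-2"] by (simp add: quartic_hess_def)
  ultimately have "y \<notin> \<Omega>" "W y \<le> g y"
    by (auto simp: MA_lower_def min_def not_le split: if_splits dest: less_imp_not_less)
       (meson linorder_not_le)+
  then have "y \<in> frontier \<Omega>" using y fr by blast
  have "W x0 \<le> W y - \<phi> y"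
    using ymax[OF x0c] \<open>\<phi> x0 = 0\<close> by simp
  also have "\<dots> \<le> g y - k * (norm (y - x0))\<^sup>2"
    using growth[OF y] \<open>W y \<le> g y\<close> by simp
  also have "g y \<le> g x0 + L * norm (y - x0)"
    using lipschitz_onD[OF lip y x0c] ug[OF x0] ug[OF \<open>y \<in> frontier \<Omega>\<close>] by (simp add: dist_norm dist_real_def)
  finally have "e \<le> L * norm (y - x0) - k * (norm (y - x0))\<^sup>2"
    by (simp add: e_def)
  \<comment> \<open>Multiplying by 4 k completes the square in |y - x0|.\<close>
  then have "4 * k * e \<le> 4 * k * (L * norm (y - x0) - k * (norm (y - x0))\<^sup>2)"
    using \<open>k > 0\<close> by (intro mult_left_mono) auto
  also have "\<dots> = L\<^sup>2 - (L - 2 * k * norm (y - x0))\<^sup>2"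
    by (simp add: power2_eq_square algebra_simps)
  also have "\<dots> \<le> L\<^sup>2" by simp
  finally have "4 * (L\<^sup>2 + 1) \<le> L\<^sup>2"
    using \<open>e > 0\<close> by (simp add: k_def)
  then show False
    using zero_le_power2[of L] by argo
qed

text \<open>A strict jump down at one point admits arbitrarily steep paraboloids from below, so the
  Monge-Ampere branch can be made negative. Only the boundary branch is left to satisfy the
  inequality.\<close>

lemma supersolution_isolated_min:
  fixes \<Omega> :: "(real^'n) set"
  assumes md: "modified_det detp" and super: "viscosity_supersolution \<Omega> detp f g W"
    and a: "a \<in> closure \<Omega>" and "W a < c" and "r > 0"
    and gap: "\<And>y. y \<in> closure \<Omega> \<Longrightarrow> dist y a < r \<Longrightarrow> y \<noteq> a \<Longrightarrow> c < W y"
  shows "a \<notin> \<Omega>" "g a \<le> W a"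
proof -
  \<comment> \<open>Exceeds the value of f at the contact point, and k \<ge> 1 gives k^n \<ge> k for
    the determinant.\<close>
  define k where "k = \<bar>f a (W a) 0\<bar> + 1"
  have "k \<ge> 1" by (simp add: k_def)
  let ?A = "mat k :: real^'n^'n"
  define \<phi> where "\<phi> = quartic a 0 0 ?A 0"
  have C2: "C2_closure \<Omega> \<phi> (quartic_grad a 0 ?A 0) (quartic_hess a ?A 0)"
    unfolding \<phi>_def by (rule C2_closure_quartic[OF mat_in_sym_matrices])
  have "\<phi> a = 0" by (simp add: \<phi>_def)
  have "continuous_on (closure \<Omega>) \<phi>" using C2 by (simp add: C2_closure_def)
  moreover have "c - W a > 0" using \<open>W a < c\<close> by simp
  ultimately obtain s where "s > 0" and s: "\<And>y. y \<in> closure \<Omega> \<Longrightarrow> dist y a < s \<Longrightarrow> dist (\<phi> y) (\<phi> a) < c - W a"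
    using a unfolding continuous_on_iff by blast
  \<comment> \<open>Near \<open>a\<close> the paraboloid rises by less than the jump c - W
    a.\<close>
  have "W y - \<phi> y \<ge> W a - \<phi> a" if "y \<in> closure \<Omega>" "y \<noteq> a" "dist y a < min r s" for y
    using gap[of y] s[of y] that \<open>\<phi> a = 0\<close> by (auto simp: dist_real_def)
  then have "\<forall>\<^sub>F y in at a within closure \<Omega>. W y - \<phi> y \<ge> W a - \<phi> a"
    unfolding eventually_at using \<open>r > 0\<close> \<open>s > 0\<close> by (intro exI[of _ "min r s"]) auto
  then have "0 \<le> MA_upper \<Omega> detp f g a (W a) (quartic_grad a 0 ?A 0 a) (quartic_hess a ?A 0 a)"
    using super C2 a unfolding viscosity_supersolution_def by blast
  moreover have "f a (W a) 0 < detp ?A"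
  proof -
    have "f a (W a) 0 < k" by (simp add: k_def)
    also have "k \<le> k ^ CARD('n)"
      using \<open>k \<ge> 1\<close> by (intro self_le_power) auto
    also have "\<dots> = detp ?A"
      using \<open>k \<ge> 1\<close> by (simp add: modified_det_mat_nonneg[OF md])
    finally show ?thesis .
  qed
  ultimately show "a \<notin> \<Omega>" "g a \<le> W a"
    by (auto simp: MA_upper_def max_def split: if_splits)
qed

section \<open>Gluing the two half-relaxed limits\<close>

text \<open>Otherwise removing any single point of \<open>E\<close> in the ball leaves a relatively
  open dense subset of \<open>E\<close>. By Baire, removing all of these countably many points
  leaves a dense set, yet it misses the ball around \<open>x\<close>.\<close>

lemma countable_closed_isolated_point:
  fixes E :: "'a::{real_normed_vector,heine_borel} set"
  assumes "closed E" "countable E" "x \<in> E" "r > 0"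
  obtains a \<rho> where "a \<in> E" "dist a x < r" "\<rho> > 0" "\<And>y. y \<in> E \<Longrightarrow> dist y a < \<rho> \<Longrightarrow> y = a"
proof (rule ccontr)
  assume none: "\<not> thesis"
  have dense: "E \<subseteq> closure (E - {a})" if "a \<in> E" "dist a x < r" for a
  proof -
    have "a \<in> closure (E - {a})"
      unfolding closure_approachable using none that \<open>\<And>a \<rho>. \<lbrakk>a \<in> E; dist a x < r; \<rho> > 0; \<And>y. y \<in> E \<Longrightarrow> dist y a < \<rho> \<Longrightarrow> y = a\<rbrakk> \<Longrightarrow> thesis\<close>
      by (metis DiffI singletonD)
    then show ?thesis
      using closure_subset[of "E - {a}"] by auto
  qed
  define \<G> where "\<G> = (\<lambda>a. E - {a}) ` (E \<inter> ball x r)"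
  have "E \<subseteq> closure (\<Inter>\<G>)"
  proof (rule Baire[OF \<open>closed E\<close>])
    show "countable \<G>"
      using \<open>countable E\<close> by (simp add: \<G>_def)
    fix T assume "T \<in> \<G>"
    then obtain a where "T = E - {a}" "a \<in> E" "dist a x < r"
      by (auto simp: \<G>_def dist_commute)
    then show "openin (top_of_set E) T \<and> E \<subseteq> closure T"
      using dense by (auto simp: openin_open intro: exI[of _ "- {a}"])
  qed
  moreover have "\<Inter>\<G> \<subseteq> - ball x r"
  proof
    fix y assume y: "y \<in> \<Inter>\<G>"
    \<comment> \<open>Shows that the family is nonempty, so that its intersection lies in
      \<open>E\<close>.\<close>
    have "E - {x} \<in> \<G>"
      using \<open>x \<in> E\<close> \<open>r > 0\<close> by (simp add: \<G>_def)
    then have "y \<in> E"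
      using y by blast
    then show "y \<in> - ball x r"
      using y unfolding \<G>_def by blast
  qed
  then have "closure (\<Inter>\<G>) \<subseteq> - ball x r"
    by (rule closure_minimal) auto
  ultimately show False
    using \<open>x \<in> E\<close> \<open>r > 0\<close> by auto
qed

lemma eventually_nhds_inf_principal:
  fixes x :: "'a::metric_space"
  shows "eventually P (inf (nhds x) (principal K)) \<longleftrightarrow> (\<exists>d>0. \<forall>y\<in>K. dist y x < d \<longrightarrow> P y)"
  unfolding eventually_inf_principal eventually_nhds_metric by (intro ex_cong1) auto

text \<open>Where the values of \<open>L\<close> are not seen off the countable set carrying \<open>U\<close>, the Baire category theorem
  provides nearby isolated downward jumps of \<open>L\<close>, at which \<open>U\<close> and \<open>L\<close> agree.\<close>

lemma function_with_prescribed_envelopes: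
  fixes U L :: "'a::euclidean_space \<Rightarrow> real"
  assumes "closed K" and usc: "usc_on K U" and lsc: "lsc_on K L"
    and le: "\<And>x. x \<in> K \<Longrightarrow> L x \<le> U x"
    and jump: "\<And>a c r. a \<in> K \<Longrightarrow> L a < c \<Longrightarrow> r > 0 \<Longrightarrow>
      (\<And>y. y \<in> K \<Longrightarrow> dist y a < r \<Longrightarrow> y \<noteq> a \<Longrightarrow> c < L y) \<Longrightarrow> U a \<le> L a"
  obtains v where "\<And>x. x \<in> K \<Longrightarrow> is_limsup (inf (nhds x) (principal K)) v (U x)"
    "\<And>x. x \<in> K \<Longrightarrow> is_limsup (inf (nhds x) (principal K)) (\<lambda>y. - v y) (- L x)"
proof -
  \<comment> \<open>Density in the graph, not merely in \<open>K\<close>, yields nearby points of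
    \<open>D\<close> at which \<open>U\<close> is almost as large as at the given point.\<close>
  obtain T where "countable T" and T: "T \<subseteq> (\<lambda>x. (x, U x)) ` K" "(\<lambda>x. (x, U x)) ` K \<subseteq> closure T"
    using separable by blast
  define D where "D = fst ` T"
  have "countable D" using \<open>countable T\<close> by (simp add: D_def)
  have near: "\<exists>y\<in>D. y \<in> K \<and> dist y x < d \<and> c < U y" if "x \<in> K" "d > 0" "c < U x" for x d c
  proof -
    have "open (ball x d \<times> {c<..})"
      by (intro open_Times) auto
    moreover have "(x, U x) \<in> (ball x d \<times> {c<..}) \<inter> closure T"
      using that T(2) by auto
    ultimately have "(ball x d \<times> {c<..}) \<inter> T \<noteq> {}"
      by (metis open_Int_closure_eq_empty empty_iff)
    then show ?thesis
      using T(1) by (force simp: D_def dist_commute)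
  qed
  define v where "v x = (if x \<in> D then U x else L x)" for x
  have "v x \<le> U x" "L x \<le> v x" if "x \<in> K" for x
    using le[OF that] by (auto simp: v_def)
  have upper: "is_limsup (inf (nhds x) (principal K)) v (U x)" if x: "x \<in> K" for x
    unfolding is_limsup_def
  proof (intro conjI allI impI)
    fix c assume "U x < c"
    then obtain r where "r > 0" "\<forall>y\<in>K. dist y x < r \<longrightarrow> U y < c"
      using usc x unfolding usc_on_metric by blast
    then show "\<forall>\<^sub>F y in inf (nhds x) (principal K). v y < c"
      unfolding eventually_nhds_inf_principal using \<open>\<And>x. x \<in> K \<Longrightarrow> v x \<le> U x\<close> by (meson le_less_trans)
  next
    fix c assume "c < U x"
    then show "\<exists>\<^sub>F y in inf (nhds x) (principal K). c < v y"
      unfolding frequently_def eventually_nhds_inf_principal v_def using near[OF x] by (metis (full_types))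
  qed
  have below: "\<exists>y\<in>K. dist y x < d \<and> v y < c" if x: "x \<in> K" and "d > 0" "L x < c" for x d c
  proof (rule ccontr)
    assume "\<not> ?thesis"
    then have big: "c \<le> v y" if "y \<in> K" "dist y x < d" for y
      using that by (meson not_le)
    define S where "S = {y \<in> K. dist y x < d \<and> L y < c}"
    \<comment> \<open>Off \<open>D\<close> the function \<open>v\<close> equals \<open>L\<close>, so
      a value of \<open>L\<close> below c would be visible there.\<close>
    have "S \<subseteq> D"
      using big by (force simp: S_def v_def split: if_splits)
    then have "countable S"
      using \<open>countable D\<close> countable_subset by blast
    then have "countable (L ` S)"
      by (rule countable_image)
    moreover have "uncountable {L x<..<c}"
      using \<open>L x < c\<close> by (simp add: uncountable_open_interval)
    ultimately have "\<not> {L x<..<c} \<subseteq> L ` S"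
      using countable_subset[of "{L x<..<c}" "L ` S"] by blast
    \<comment> \<open>Avoiding the countably many values of \<open>L\<close> on \<open>S\<close>
      makes L a < b strict at every point a of the sublevel set; at an isolated point this is a
      genuine jump across b.\<close>
    then obtain b where b: "L x < b" "b < c" "b \<notin> L ` S"
      by (metis greaterThanLessThan_iff subsetI)
    \<comment> \<open>Closed by lower semicontinuity. Halving the radius keeps the closed ball
      inside the open one, so that \<open>E\<close> lies in the countable set
      \<open>S\<close>.\<close>
    define E where "E = {y \<in> K \<inter> cball x (d / 2). L y \<le> b}"
    have "E \<subseteq> S"
      using b \<open>d > 0\<close> by (auto simp: E_def S_def dist_commute)
    have "closed E"
    proof -
      have "y \<in> E" if y: "y \<in> closure E" for y
      proof -
        have "closure E \<subseteq> K \<inter> cball x (d / 2)"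
          using \<open>closed K\<close> by (intro closure_minimal) (auto simp: E_def)
        then have "y \<in> K" "y \<in> cball x (d / 2)" using y by auto
        moreover have "L y \<le> b"
        proof (rule ccontr)
          assume "\<not> L y \<le> b"
          then have "- L y < - b" by simp
          then obtain r where "r > 0" and r: "\<forall>z\<in>K. dist z y < r \<longrightarrow> - L z < - b"
            using lsc \<open>y \<in> K\<close> unfolding lsc_on_iff_usc_on_uminus usc_on_metric by blast
          obtain z where "z \<in> E" "dist z y < r"
            using y \<open>r > 0\<close> unfolding closure_approachable by blast
          then show False
            using r by (auto simp: E_def)
        qed
        ultimately show ?thesis by (simp add: E_def)
      qed
      then show ?thesis
        using closure_subset_eq by blast
    qed
    have "countable E"
      using \<open>E \<subseteq> S\<close> \<open>countable S\<close> countable_subset by blast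
    have "x \<in> E" "d / 2 > 0"
      using x b \<open>d > 0\<close> by (auto simp: E_def)
    then obtain a \<rho> where a: "a \<in> E" "dist a x < d / 2" and "\<rho> > 0"
      and iso: "\<And>y. y \<in> E \<Longrightarrow> dist y a < \<rho> \<Longrightarrow> y = a"
      by (rule countable_closed_isolated_point[OF \<open>closed E\<close> \<open>countable E\<close>]) blast
    have aK: "a \<in> K" "a \<in> S" using a \<open>E \<subseteq> S\<close> by (auto simp: E_def)
    have "L a \<noteq> b" using b(3) aK(2) by auto
    then have "L a < b" using a by (auto simp: E_def)
    have "b < L y" if "y \<in> K" "dist y a < min \<rho> (d / 2 - dist a x)" "y \<noteq> a" for y
    proof (rule ccontr)
      assume "\<not> b < L y"
      moreover have "dist y x \<le> d / 2"
        using that(2) dist_triangle[of y x a] by simp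
      ultimately have "y \<in> E"
        using that(1) by (simp add: E_def dist_commute)
      then show False
        using iso[of y] that(2,3) by simp
    qed
    then have "U a \<le> L a"
      using jump[OF aK(1) \<open>L a < b\<close>, of "min \<rho> (d / 2 - dist a x)"] \<open>\<rho> > 0\<close> a(2) by auto
    \<comment> \<open>With U a \<le> L a it no longer matters whether \<open>a\<close> lies in
      \<open>D\<close>; \<open>v\<close> is below c at \<open>a\<close> after all.\<close>
    then have "v a \<le> L a" by (simp add: v_def)
    then show False
      using big[OF aK(1)] a(2) \<open>L a < b\<close> b(2) \<open>d > 0\<close> by simp
  qed
  have lower: "is_limsup (inf (nhds x) (principal K)) (\<lambda>y. - v y) (- L x)" if x: "x \<in> K" for x
    unfolding is_limsup_def
  proof (intro conjI allI impI)
    fix c assume "- L x < c"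
    then obtain r where "r > 0" "\<forall>y\<in>K. dist y x < r \<longrightarrow> - L y < c"
      using lsc x unfolding lsc_on_iff_usc_on_uminus usc_on_metric by blast
    then show "\<forall>\<^sub>F y in inf (nhds x) (principal K). - v y < c"
      unfolding eventually_nhds_inf_principal using \<open>\<And>x. x \<in> K \<Longrightarrow> L x \<le> v x\<close>
      by (meson le_less_trans neg_le_iff_le)
  next
    fix c assume "c < - L x"
    then have "L x < - c" by simp
    then have "\<exists>y\<in>K. dist y x < d \<and> c < - v y" if "d > 0" for d
      using below[OF x that, of "- c"] by (auto simp: less_minus_iff)
    then show "\<exists>\<^sub>F y in inf (nhds x) (principal K). c < - v y"
      unfolding frequently_def eventually_nhds_inf_principal by blast
  qed
  from upper lower show ?thesis by (rule that)
qed

section \<open>Comparison of limits and convergence of the scheme\<close>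

lemma is_limsup_tendsto_eq:
  assumes "(w \<longlongrightarrow> l) \<F>" "\<F> \<noteq> bot" "is_limsup \<F> w l'"
  shows "l' = l"
proof -
  have "Limsup \<F> (\<lambda>y. ereal (w y)) = ereal l"
    using assms by (intro lim_imp_Limsup) (auto intro: tendsto_ereal)
  then show ?thesis
    using is_limsup_imp_Limsup[OF assms(3)] by simp
qed

lemma is_limsup_uminus_le:
  assumes "\<F> \<noteq> bot" "is_limsup \<F> w l" "is_limsup \<F> (\<lambda>y. - w y) (- l')"
  shows "l' \<le> l"
proof (rule ccontr)
  assume "\<not> l' \<le> l"
  then obtain c where c: "l < c" "c < l'"
    using dense not_le by blast
  then have "\<forall>\<^sub>F y in \<F>. w y < c"
    using assms(2) by (simp add: is_limsup_def)
  moreover have "\<forall>\<^sub>F y in \<F>. - w y < - c"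
    using assms(3) c(2) unfolding is_limsup_def by (metis neg_less_iff_less)
  ultimately have "\<forall>\<^sub>F y in \<F>. False"
    by eventually_elim simp
  then show False
    using \<open>\<F> \<noteq> bot\<close> by (simp add: eventually_False)
qed

lemma eventually_grid_nhds_along:
  assumes "eventually P (grid_nhds Gr x)" and "\<And>h. 0 < h \<Longrightarrow> z h \<in> Gr h" and "(z \<longlongrightarrow> x) (at_right 0)"
  shows "\<forall>\<^sub>F h in at_right 0. P (h, z h)"
proof -
  obtain d where "d > 0" and d: "\<And>h z. 0 < h \<Longrightarrow> h < d \<Longrightarrow> dist z x < d \<Longrightarrow> z \<in> Gr h \<Longrightarrow> P (h, z)"
    using assms(1) unfolding eventually_grid_nhds by blast
  have "\<forall>\<^sub>F h in at_right 0. 0 < h \<and> h < d"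
    unfolding eventually_at_right_0 using \<open>d > 0\<close> by blast
  moreover have "\<forall>\<^sub>F h in at_right 0. dist (z h) x < d"
    using assms(3) \<open>d > 0\<close> by (rule tendstoD)
  ultimately show ?thesis
    by eventually_elim (use d assms(2) in auto)
qed

theorem corollary14:
  fixes \<Omega> :: "(real^'n) set"
    and detp :: "real^'n^'n \<Rightarrow> real"
    and f :: "real^'n \<Rightarrow> real \<Rightarrow> real^'n \<Rightarrow> real"
    and g :: "real^'n \<Rightarrow> real"
    and u :: "real^'n \<Rightarrow> real"
    and Gr :: "real \<Rightarrow> (real^'n) set"
    and F :: "real \<Rightarrow> real^'n \<Rightarrow> real \<Rightarrow> (real^'n \<Rightarrow> real) \<Rightarrow> real"
    and uh :: "real \<Rightarrow> real^'n \<Rightarrow> real"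
  assumes "open \<Omega>" and "uniformly_convex \<Omega>"
    and "modified_det detp"
    and "continuous_on (closure \<Omega> \<times> UNIV \<times> UNIV) (\<lambda>(x, s, p). f x s p)"
    and "\<And>x s p. x \<in> closure \<Omega> \<Longrightarrow> 0 \<le> f x s p"
    and "\<And>x s t p. x \<in> closure \<Omega> \<Longrightarrow> s \<le> t \<Longrightarrow> f x s p \<le> f x t p"
    and "\<And>R. R > 0 \<Longrightarrow> \<exists>C\<ge>0. \<forall>x\<in>closure \<Omega>. \<forall>s p q.
           \<bar>s\<bar> \<le> R \<longrightarrow> norm p \<le> R \<longrightarrow> norm q \<le> R \<longrightarrow>
           \<bar>root CARD('n) (f x s p) - root CARD('n) (f x s q)\<bar> \<le> C * norm (p - q)"
    and "\<exists>L. L-lipschitz_on (closure \<Omega>) u"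
    and "\<And>x. x \<in> frontier \<Omega> \<Longrightarrow> u x = g x"
    and "viscosity_solution \<Omega> detp f g u"
    and "\<And>v. viscosity_solution \<Omega> detp f g v \<Longrightarrow> \<forall>x\<in>closure \<Omega>. v x = u x"
    and "grid_family \<Omega> Gr"
    and "scheme_consistent \<Omega> detp f g Gr F"
    and "scheme_monotone Gr F"
    and "scheme_stable Gr F"
    and "\<And>h. h > 0 \<Longrightarrow> scheme_solution Gr F h (uh h)"
  shows "\<forall>x\<in>closure \<Omega>. \<forall>z. (\<forall>h>0. z h \<in> Gr h) \<longrightarrow> (z \<longlongrightarrow> x) (at_right 0) \<longrightarrow>
           ((\<lambda>h. uh h (z h)) \<longlongrightarrow> u x) (at_right 0)"
proof -
  note md = \<open>modified_det detp\<close> and sol = assms(16)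
  let ?K = "closure \<Omega>"
  have "convex \<Omega>" "bounded \<Omega>"
    using \<open>uniformly_convex \<Omega>\<close> by (auto simp: uniformly_convex_def)
  have fr: "frontier \<Omega> = ?K - \<Omega>"
    using \<open>open \<Omega>\<close> by (simp add: frontier_def interior_open)
  obtain L0 where lip: "L0-lipschitz_on ?K u"
    using assms(8) by blast
  have grid: "finite (Gr h) \<and> Gr h \<subseteq> ?K" if "0 < h" for h
    using \<open>grid_family \<Omega> Gr\<close> that by (auto simp: grid_family_def)
  \<comment> \<open>Every point is a limit of grid points, so the filter is proper; the existence of
    real half-relaxed limits and the inequality L \<le> U both rest on this.\<close>
  have nontriv: "grid_nhds Gr x \<noteq> bot" if x: "x \<in> ?K" for x
  proof
    assume "grid_nhds Gr x = bot"
    then have "eventually (\<lambda>_. False) (grid_nhds Gr x)" by simp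
    moreover obtain z where "\<And>h. 0 < h \<Longrightarrow> z h \<in> Gr h" "(z \<longlongrightarrow> x) (at_right 0)"
      using \<open>grid_family \<Omega> Gr\<close> x unfolding grid_family_def by blast
    ultimately have "\<forall>\<^sub>F h::real in at_right 0. False"
      using eventually_grid_nhds_along[where P = "\<lambda>_. False"] by blast
    then show False by (simp add: eventually_False)
  qed
  obtain M where M: "\<forall>\<^sub>F h in at_right 0. \<forall>u. scheme_solution Gr F h u \<longrightarrow> (\<forall>x\<in>Gr h. \<bar>u x\<bar> \<le> M)"
    using \<open>scheme_stable Gr F\<close> unfolding scheme_stable_def by blast
  then obtain d0 where "d0 > 0" and d0: "\<And>h z. 0 < h \<Longrightarrow> h < d0 \<Longrightarrow> z \<in> Gr h \<Longrightarrow> \<bar>uh h z\<bar> \<le> M"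
    unfolding eventually_at_right_0 using sol by blast
  have bounded: "\<forall>\<^sub>F q in grid_nhds Gr x. \<bar>case q of (h, z) \<Rightarrow> uh h z\<bar> \<le> M"
    "\<forall>\<^sub>F q in grid_nhds Gr x. \<bar>case q of (h, z) \<Rightarrow> - uh h z\<bar> \<le> M" for x
    unfolding eventually_grid_nhds using d0 \<open>d0 > 0\<close> by auto
  have "\<forall>x\<in>?K. \<exists>l. is_limsup (grid_nhds Gr x) (\<lambda>(h, z). uh h z) l \<and> \<bar>l\<bar> \<le> M"
    using is_limsup_exists[OF nontriv bounded(1)] by metis
  then obtain U where U: "\<And>x. x \<in> ?K \<Longrightarrow> is_limsup (grid_nhds Gr x) (\<lambda>(h, z). uh h z) (U x)"
    and UM: "\<And>x. x \<in> ?K \<Longrightarrow> \<bar>U x\<bar> \<le> M"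
    by metis
  have "\<forall>x\<in>?K. \<exists>l. is_limsup (grid_nhds Gr x) (\<lambda>(h, z). - uh h z) (- l) \<and> \<bar>l\<bar> \<le> M"
    using is_limsup_exists[OF nontriv bounded(2)] by (metis abs_minus_cancel minus_minus)
  then obtain L where L: "\<And>x. x \<in> ?K \<Longrightarrow> is_limsup (grid_nhds Gr x) (\<lambda>(h, z). - uh h z) (- L x)"
    and LM: "\<And>x. x \<in> ?K \<Longrightarrow> \<bar>L x\<bar> \<le> M"
    by metis
  have uscU: "usc_on ?K U"
    using U by (rule grid_limsup_usc_on)
  have lscL: "lsc_on ?K L"
    unfolding lsc_on_iff_usc_on_uminus using L by (rule grid_limsup_usc_on)
  have UleM: "U x \<le> M" and LgeM: "- M \<le> L x" if "x \<in> ?K" for x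
    using UM[OF that] LM[OF that] by simp_all
  have sub: "viscosity_subsolution \<Omega> detp f g U"
    unfolding viscosity_subsolution_def
  proof (intro conjI allI impI ballI)
    fix \<phi> G H x
    assume "C2_closure \<Omega> \<phi> G H" "x \<in> ?K" "\<forall>\<^sub>F y in at x within ?K. U y - \<phi> y \<le> U x - \<phi> x"
    then show "MA_lower \<Omega> detp f g x (U x) (G x) (H x) \<le> 0"
      by - (rule scheme_limsup_subsolution_at[of \<Omega> detp Gr f g F uh U M],
        (assumption | rule \<open>open \<Omega>\<close> \<open>convex \<Omega>\<close> \<open>bounded \<Omega>\<close> md grid sol U UleM
          \<open>scheme_consistent \<Omega> detp f g Gr F\<close> \<open>scheme_monotone Gr F\<close>)+)
  qed (rule uscU)
  have super: "viscosity_supersolution \<Omega> detp f g L"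
    unfolding viscosity_supersolution_def
  proof (intro conjI allI impI ballI)
    fix \<phi> G H x
    assume "C2_closure \<Omega> \<phi> G H" "x \<in> ?K" "\<forall>\<^sub>F y in at x within ?K. L y - \<phi> y \<ge> L x - \<phi> x"
    then show "0 \<le> MA_upper \<Omega> detp f g x (L x) (G x) (H x)"
      by - (rule scheme_liminf_supersolution_at[of \<Omega> detp Gr f g F uh L M],
        (assumption | rule \<open>open \<Omega>\<close> \<open>convex \<Omega>\<close> \<open>bounded \<Omega>\<close> md grid sol L LgeM
          \<open>scheme_consistent \<Omega> detp f g Gr F\<close> \<open>scheme_monotone Gr F\<close>)+)
  qed (rule lscL)
  have le: "L x \<le> U x" if "x \<in> ?K" for x
    using nontriv[OF that] U[OF that] L[OF that]
    by (intro is_limsup_uminus_le) (auto simp: case_prod_unfold)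
  have jump: "U a \<le> L a" if a: "a \<in> ?K" "L a < c" "r > 0"
    "\<And>y. y \<in> ?K \<Longrightarrow> dist y a < r \<Longrightarrow> y \<noteq> a \<Longrightarrow> c < L y" for a c r
  proof -
    have "a \<notin> \<Omega>" "g a \<le> L a"
      using supersolution_isolated_min[OF md super a] by simp_all
    moreover have "U a \<le> g a"
      using a(1) \<open>a \<notin> \<Omega>\<close> fr
      by (intro subsolution_le_boundary_data[OF \<open>open \<Omega>\<close> \<open>uniformly_convex \<Omega>\<close> md assms(5) lip assms(9) sub]) auto
    ultimately show ?thesis by simp
  qed
  obtain v where vU: "\<And>x. x \<in> ?K \<Longrightarrow> is_limsup (inf (nhds x) (principal ?K)) v (U x)"
    and vL: "\<And>x. x \<in> ?K \<Longrightarrow> is_limsup (inf (nhds x) (principal ?K)) (\<lambda>y. - v y) (- L x)"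
    by (rule function_with_prescribed_envelopes[of ?K U L]) (assumption | rule closed_closure uscU lscL le jump | blast)+
  have "viscosity_solution \<Omega> detp f g v"
    unfolding viscosity_solution_def usc_envelope_def lsc_envelope_def
    using sub super is_limsup_imp_Limsup[OF vU] is_limsup_uminus_imp_Liminf[OF vL] by metis
  then have vu: "\<And>x. x \<in> ?K \<Longrightarrow> v x = u x"
    using assms(11) by blast
  have Uu: "U x = u x" and Lu: "L x = u x" if x: "x \<in> ?K" for x
  proof -
    have "continuous_on ?K v"
      using lipschitz_on_continuous_on[OF lip] vu by (simp cong: continuous_on_cong)
    then have lim: "(v \<longlongrightarrow> u x) (inf (nhds x) (principal ?K))"
      unfolding tendsto_iff eventually_nhds_inf_principal using x vu[OF x] unfolding continuous_on_iff by metis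
    have nb: "inf (nhds x) (principal ?K) \<noteq> bot"
    proof
      assume "inf (nhds x) (principal ?K) = bot"
      then have "eventually (\<lambda>_. False) (inf (nhds x) (principal ?K))" by simp
      then show False
        unfolding eventually_nhds_inf_principal using x by (metis dist_self)
    qed
    show "U x = u x"
      using lim nb vU[OF x] by (rule is_limsup_tendsto_eq)
    have "- L x = - u x"
      using tendsto_minus[OF lim] nb vL[OF x] by (rule is_limsup_tendsto_eq)
    then show "L x = u x" by simp
  qed
  show ?thesis
  \<comment> \<open>The identity U = u gives eventual upper bounds along any grid points tending to
    x, and L = u gives the lower ones.\<close>
  proof (intro ballI allI impI order_tendstoI)
    fix x z c
    assume x: "x \<in> ?K" and z: "\<forall>h>0. z h \<in> Gr h" "(z \<longlongrightarrow> x) (at_right 0)"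
    show "\<forall>\<^sub>F h in at_right 0. uh h (z h) < c" if "u x < c"
    proof -
      have "\<forall>\<^sub>F q in grid_nhds Gr x. (case q of (h, z) \<Rightarrow> uh h z) < c"
        using U[OF x] that Uu[OF x] by (simp add: is_limsup_def)
      from eventually_grid_nhds_along[OF this _ z(2)] z(1) show ?thesis by simp
    qed
    show "\<forall>\<^sub>F h in at_right 0. c < uh h (z h)" if "c < u x"
    proof -
      have "\<forall>\<^sub>F q in grid_nhds Gr x. (case q of (h, z) \<Rightarrow> - uh h z) < - c"
        using L[OF x] that Lu[OF x] by (simp add: is_limsup_def)
      from eventually_grid_nhds_along[OF this _ z(2)] z(1) show ?thesis by simp
    qed
  qed
qed

end
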